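(* There is an absolute constant $C\ge1$ such that for all integers $0<s\le n$ and all $0<\delta<1$ with $(s/(10n))^4<\delta$, and for every integer $m$ with $C\delta^{-2}s\log_+\frac ns\le m\le 2C\delta^{-2}s\log_+\frac ns$, if $g_1,\dots,g_m$ are i.i.d. standard gaussian vectors in $\mathbb R^{n+1}$, then with probability at least $1-(\frac s{2n})^{2s}$, $$\sup_{x,y\in K_s}\Bigl|\frac1m\sum_{j=1}^m\operatorname{sgn}(\langle x,g_j\rangle)\langle y,g_j\rangle-\lambda\langle x,y\rangle\Bigr|\le\delta,\qquad\lambda=\sqrt{2/\pi}.$$
   Context: $K_s:=\{x\in\mathbb R^{n+1}:\|x\|_2=1,\ \#\{j:x_j\ne0\}\le s\}$. $\log_+t:=\max\{1,\log t\}$. *)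

theory Defs
  imports "HOL-Probability.Probability"
begin

definition log_plus :: "real \<Rightarrow> real" where
  "log_plus t = max 1 (ln t)"

text \<open>Vectors of R^(n+1) are functions nat => real vanishing outside {0..n}.\<close>
definition sparse_sphere :: "nat \<Rightarrow> nat \<Rightarrow> (nat \<Rightarrow> real) set" where
  "sparse_sphere n s = {x. (\<forall>i>n. x i = 0) \<and> sqrt (\<Sum>i\<le>n. (x i)\<^sup>2) = 1
                           \<and> card {j\<in>{..n}. x j \<noteq> 0} \<le> s}"

definition std_normal_measure :: "real measure" where
  "std_normal_measure = density lborel std_normal_density"

text \<open>m i.i.d. standard gaussian vectors g_0..g_(m-1) in R^(n+1): the entry i of g_j is w (j,i);
  all m(n+1) entries are i.i.d. N(0,1).\<close>
definition gauss_space :: "nat \<Rightarrow> nat \<Rightarrow> (nat \<times> nat \<Rightarrow> real) measure" where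
  "gauss_space m n = PiM ({..<m} \<times> {..n}) (\<lambda>_. std_normal_measure)"

definition ip :: "nat \<Rightarrow> (nat \<Rightarrow> real) \<Rightarrow> (nat \<Rightarrow> real) \<Rightarrow> real" where
  "ip n x y = (\<Sum>i\<le>n. x i * y i)"

end

theory Submission
  imports Defs
begin

text \<open>
  For fixed unit vectors the average is a sum of independent subgaussian variables with mean
  \<open>sqrt (2 / pi) <x, y>\<close>, so its deviation has a gaussian tail. Approximate \<open>x\<close> and \<open>y\<close> by points \<open>u\<close> and \<open>v\<close>
  of a \<open>\<rho>\<close>-net with smaller support. The operator norm of the gaussian matrix on sparse vectors is
  controlled by its values on the net. The signs of \<open><x, g>\<close> and \<open><u, g>\<close> can only differ if
  \<open>|<u, g>| \<le> t\<close>, which a Chernoff bound makes rare, or if \<open>|<x - u, g>| \<ge> t\<close>, which the operator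
  norm makes rare; by Cauchy-Schwarz the changed signs cost at most \<open>\<delta> / 2\<close> when \<open>t\<close> is of order
  \<open>\<delta>\<^sup>2\<close> and \<open>\<rho>\<close> of order \<open>\<delta>\<^sup>3\<close>. Since \<open>\<delta> > (s / (10 n))^4\<close>, the logarithm of the size of such a net is
  of order \<open>s log_plus (n / s)\<close>, so a union bound over the net suffices and no chaining is needed.
\<close>

subsection \<open>Measurability of the uniform event\<close>

text \<open>The good event is an uncountable intersection, and \<open>measure\<close> is 0 on a
  nonmeasurable set, so the lower bound on the probability requires measurability. As
  \<open>sgn\<close> is discontinuous, restricting \<open>x\<close> to a dense subset is not enough;
  sign patterns are treated one at a time. The discontinuity is also why no Lipschitz estimate
  carries the deviation from the net to the sphere. Sign changes are measured in squared mean
  instead: a threshold \<open>t\<close> of order \<delta>^2 keeps the share of small products within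
  the allowed order \<delta>^2, and the quotient \<rho>/t must then be of order \<delta>, so \<rho>
  is of order \<delta>^3. The union bound compares exponents, with L =
  \<open>log_plus (n / s)\<close>: pairs of net points cost at most 154 s L, the target probability
  costs 4 s L, and the sample size pays at least 160 s L at the slowest rate, m \<delta>^2 / 1024.
  This is the origin of the constant 200000.\<close>

lemma sets_exists_compact_le_zero:
  fixes F :: "'a::{metric_space,second_countable_topology} \<Rightarrow> 'w \<Rightarrow> real"
  assumes K: "compact K"
    and cont: "\<And>w. w \<in> space M \<Longrightarrow> continuous_on K (\<lambda>x. F x w)"
    and meas: "\<And>x. x \<in> K \<Longrightarrow> F x \<in> borel_measurable M"
  shows "{w \<in> space M. \<exists>x\<in>K. F x w \<le> 0} \<in> sets M"
proof -
  obtain D where D: "countable D" "D \<subseteq> K" "K \<subseteq> closure D"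
    using separable by blast
  \<comment> \<open>On a compact set a continuous function attains its infimum, so a point with
    value at most 0 exists iff the infimum is below every \<open>1 / Suc k\<close>; by continuity
    this can be tested on the countable dense set \<open>D\<close>.\<close>
  have eq: "{w \<in> space M. \<exists>x\<in>K. F x w \<le> 0} =
      space M \<inter> (\<Inter>k. \<Union>x\<in>D. {w \<in> space M. F x w < 1 / real (Suc k)})"
  proof (intro equalityI subsetI IntI INT_I)
    fix w k assume "w \<in> {w \<in> space M. \<exists>x\<in>K. F x w \<le> 0}"
    then obtain x where w: "w \<in> space M" and x: "x \<in> K" "F x w \<le> 0" by auto
    have "0 < 1 / real (Suc k)" by simp
    then obtain d where d: "d > 0" "\<And>x'. x' \<in> K \<Longrightarrow> dist x' x < d \<Longrightarrow> dist (F x' w) (F x w) < 1 / real (Suc k)"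
      using cont[OF w] x(1) unfolding continuous_on_iff by blast
    obtain x' where x': "x' \<in> D" "dist x' x < d"
      using x(1) D(3) d(1) closure_approachable by blast
    have "F x' w < 1 / real (Suc k)"
      using d(2)[of x'] x' D(2) x(2) by (auto simp: dist_real_def)
    then show "w \<in> (\<Union>x\<in>D. {w \<in> space M. F x w < 1 / real (Suc k)})" using w x' by auto
  next
    fix w assume *: "w \<in> space M \<inter> (\<Inter>k. \<Union>x\<in>D. {w \<in> space M. F x w < 1 / real (Suc k)})"
    then have w: "w \<in> space M" by simp
    have ne: "K \<noteq> {}" using * D(2) by fastforce
    obtain x where x: "x \<in> K" "\<And>y. y \<in> K \<Longrightarrow> F x w \<le> F y w"
      using continuous_attains_inf[OF K ne cont[OF w]] by blast
    have "F x w \<le> 0"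
    proof (rule ccontr)
      assume "\<not> F x w \<le> 0"
      then obtain k where "1 / real (Suc k) < F x w"
        using reals_Archimedean[of "F x w"] by (auto simp: inverse_eq_divide)
      moreover obtain y where "y \<in> D" "F y w < 1 / real (Suc k)" using * by blast
      ultimately show False using x(2)[of y] D(2) by auto
    qed
    then show "w \<in> {w \<in> space M. \<exists>x\<in>K. F x w \<le> 0}" using w x by auto
  qed auto
  have "{w \<in> space M. F x w < 1 / real (Suc k)} \<in> sets M" if "x \<in> D" for x k
    using meas[of x] that D(2) by (intro borel_measurable_less) auto
  then have "(\<Union>x\<in>D. {w \<in> space M. F x w < 1 / real (Suc k)}) \<in> sets M" for k
    using D(1) by (intro sets.countable_UN') auto
  then have "(\<Inter>k. \<Union>x\<in>D. {w \<in> space M. F x w < 1 / real (Suc k)}) \<in> sets M"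
    by (intro sets.countable_INT) auto
  then show ?thesis unfolding eq by (intro sets.Int sets.top)
qed

lemma sparse_sphere_iff:
  "x \<in> sparse_sphere n s \<longleftrightarrow> (\<forall>i>n. x i = 0) \<and> ip n x x = 1 \<and> card {j\<in>{..n}. x j \<noteq> 0} \<le> s"
  by (auto simp: sparse_sphere_def ip_def power2_eq_square)

lemma continuous_on_ip:
  assumes "continuous_on A f" "continuous_on A g"
  shows "continuous_on A (\<lambda>p. ip n (f p) (g p))"
  unfolding ip_def
  by (intro continuous_on_sum continuous_on_mult assms[THEN continuous_on_product_then_coordinatewise])

text \<open>There are finitely many supports, and for each of them the conditions are closed inside
  a product of intervals. Vectors are functions on all of \<open>nat\<close>, so compactness is in
  the product topology and comes from Tychonoff.\<close>

lemma compact_sparse_sphere: "compact (sparse_sphere n s)"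
proof -
  have box: "compact (PiE UNIV (\<lambda>_::nat. {-1..1::real}))"
    using compactin_PiE[of "\<lambda>_::nat. euclidean :: real topology" UNIV "\<lambda>_. {-1..1}"]
    by (simp add: euclidean_product_topology)
  have cl: "closed {x::nat\<Rightarrow>real. (\<forall>i. i \<notin> S \<longrightarrow> x i = 0) \<and> ip n x x = 1}" for S
  proof -
    have "{x::nat\<Rightarrow>real. (\<forall>i. i \<notin> S \<longrightarrow> x i = 0) \<and> ip n x x = 1} =
       (\<Inter>i\<in>-S. {x. x i = 0}) \<inter> {x. ip n x x = 1}" by auto
    also have "closed \<dots>"
      by (intro closed_Int closed_INT ballI closed_Collect_eq continuous_on_const continuous_on_ip
          continuous_on_product_coordinates continuous_on_id)
    finally show ?thesis .
  qed
  have eq: "sparse_sphere n s = (\<Union>S\<in>{S. S \<subseteq> {..n} \<and> card S \<le> s}.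
      PiE UNIV (\<lambda>_. {-1..1}) \<inter> {x. (\<forall>i. i \<notin> S \<longrightarrow> x i = 0) \<and> ip n x x = 1})"
  proof (intro equalityI subsetI)
    fix x assume x: "x \<in> sparse_sphere n s"
    have "x i \<in> {-1..1}" for i
    proof (cases "i \<le> n")
      case True
      have "(x i)\<^sup>2 \<le> ip n x x" unfolding ip_def power2_eq_square
        using True by (intro member_le_sum) auto
      then have "(x i)\<^sup>2 \<le> 1" using x by (simp add: sparse_sphere_iff)
      then have "\<bar>x i\<bar> \<le> 1" by (simp add: abs_square_le_1)
      then show ?thesis by (auto simp: abs_le_iff)
    next
      case False
      then have "x i = 0" using x by (auto simp: sparse_sphere_iff)
      then show ?thesis by simp
    qed
    then have "x \<in> PiE UNIV (\<lambda>_. {-1..1})" by (simp add: PiE_UNIV_domain)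
    moreover have "\<forall>i. i \<notin> {j\<in>{..n}. x j \<noteq> 0} \<longrightarrow> x i = 0" "ip n x x = 1"
      using x by (auto simp: sparse_sphere_iff not_le)
    moreover have "{j\<in>{..n}. x j \<noteq> 0} \<subseteq> {..n}" "card {j\<in>{..n}. x j \<noteq> 0} \<le> s"
      using x by (auto simp: sparse_sphere_iff)
    ultimately show "x \<in> (\<Union>S\<in>{S. S \<subseteq> {..n} \<and> card S \<le> s}.
      PiE UNIV (\<lambda>_. {-1..1}) \<inter> {x. (\<forall>i. i \<notin> S \<longrightarrow> x i = 0) \<and> ip n x x = 1})"
      by (intro UN_I[of "{j\<in>{..n}. x j \<noteq> 0}"] IntI CollectI conjI)
  next
    fix x assume "x \<in> (\<Union>S\<in>{S. S \<subseteq> {..n} \<and> card S \<le> s}.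
      PiE UNIV (\<lambda>_. {-1..1}) \<inter> {x. (\<forall>i. i \<notin> S \<longrightarrow> x i = 0) \<and> ip n x x = 1})"
    then obtain S where S: "S \<subseteq> {..n}" "card S \<le> s" "\<forall>i. i \<notin> S \<longrightarrow> x i = 0" "ip n x x = 1" by auto
    have "card {j\<in>{..n}. x j \<noteq> 0} \<le> card S"
      using S finite_subset[OF S(1)] by (intro card_mono) auto
    with S show "x \<in> sparse_sphere n s" by (auto simp: sparse_sphere_iff)
  qed
  have "finite {S. S \<subseteq> {..n} \<and> card S \<le> s}" by (rule finite_subset[of _ "Pow {..n}"]) auto
  then show ?thesis unfolding eq by (intro compact_UN ballI compact_Int_closed box cl)
qed

abbreviation (input) avg :: "nat \<Rightarrow> (nat \<Rightarrow> real) \<Rightarrow> real"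
  where "avg m a \<equiv> (1 / real m) * (\<Sum>j<m. a j)"

definition gvec :: "(nat \<times> nat \<Rightarrow> real) \<Rightarrow> nat \<Rightarrow> nat \<Rightarrow> real"
  where "gvec w j = (\<lambda>i. w (j, i))"

lemma measurable_entry [measurable]:
  assumes "j < m" "i \<le> n"
  shows "(\<lambda>w. w (j, i)) \<in> borel_measurable (gauss_space m n)"
  unfolding gauss_space_def
  using assms measurable_PiM_component_rev[of "(j,i)" "{..<m} \<times> {..n}" "\<lambda>x. x" "\<lambda>_. std_normal_measure" borel]
  by (simp add: std_normal_measure_def)

lemma measurable_ip_gvec [measurable]:
  assumes "j < m"
  shows "(\<lambda>w. ip n x (gvec w j)) \<in> borel_measurable (gauss_space m n)"
  unfolding ip_def gvec_def using assms measurable_entry by (intro borel_measurable_sum borel_measurable_times) auto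

text \<open>For a prescribed sign pattern the violation is a countable union of closed conditions on
  \<open>(x, y)\<close> in a compact set; each is the zero set of a nonnegative continuous function.\<close>
lemma sets_uniform_deviation:
  "{w \<in> space (gauss_space m n). \<forall>x\<in>sparse_sphere n s. \<forall>y\<in>sparse_sphere n s.
      \<bar>avg m (\<lambda>j. sgn (ip n x (gvec w j)) * ip n y (gvec w j)) - c * ip n x y\<bar> \<le> \<delta>}
    \<in> sets (gauss_space m n)" (is "?G \<in> sets ?M")
proof -
  \<comment> \<open>The set where \<open>sgn u = e\<close> is open for \<open>e \<noteq> 0\<close>
    and closed for \<open>e = 0\<close>. In the open case it is exhausted by the closed sets
    \<open>e * u \<ge> 1 / Suc k\<close>, and \<open>h\<close> vanishes exactly on these; the margin
    in \<open>F\<close> treats the strict violation of \<open>\<delta>\<close> the same way.\<close>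
  define h :: "real \<Rightarrow> nat \<Rightarrow> real \<Rightarrow> real"
    where "h e k u = (if e = 0 then \<bar>u\<bar> else max 0 (1 / real (Suc k) - e * u))" for e k u
  define V where "V e x y w = \<bar>avg m (\<lambda>j. e j * ip n y (gvec w j)) - c * ip n x y\<bar>"
    for e :: "nat \<Rightarrow> real" and x y w
  define F where "F e k p w = (\<Sum>j<m. h (e j) k (ip n (fst p) (gvec w j)))
      + max 0 (\<delta> + 1 / real (Suc k) - V e (fst p) (snd p) w)" for e k p w
  let ?K = "sparse_sphere n s \<times> sparse_sphere n s"
  let ?E = "PiE {..<m} (\<lambda>_. {-1, 0, 1::real})"
  have h_nonneg: "0 \<le> h e k u" for e k u by (simp add: h_def)
  have h_zero: "sgn u = e" if "h e k u = 0" "e \<in> {-1,0,1}" for e k u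
  proof (cases "e = 0")
    case True
    then show ?thesis using that by (simp add: h_def)
  next
    case False
    have "0 < 1 / real (Suc k)" by simp
    also have "\<dots> \<le> e * u" using that False by (simp add: h_def max_def split: if_splits)
    finally show ?thesis using that(2) False by (auto simp: sgn_if)
  qed
  have F_zero: "F e k p w \<le> 0 \<longleftrightarrow> (\<forall>j<m. h (e j) k (ip n (fst p) (gvec w j)) = 0) \<and>
      \<delta> + 1 / real (Suc k) \<le> V e (fst p) (snd p) w" for e k p w
  proof -
    have "0 \<le> (\<Sum>j<m. h (e j) k (ip n (fst p) (gvec w j)))" by (intro sum_nonneg h_nonneg)
    then have "F e k p w \<le> 0 \<longleftrightarrow> (\<Sum>j<m. h (e j) k (ip n (fst p) (gvec w j))) = 0 \<and>
      \<delta> + 1 / real (Suc k) \<le> V e (fst p) (snd p) w" by (auto simp: F_def)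
    also have "(\<Sum>j<m. h (e j) k (ip n (fst p) (gvec w j))) = 0 \<longleftrightarrow>
        (\<forall>j<m. h (e j) k (ip n (fst p) (gvec w j)) = 0)"
      by (subst sum_nonneg_eq_0_iff) (auto simp: h_nonneg)
    finally show ?thesis .
  qed
  have eq: "?G = space ?M - (\<Union>e\<in>?E. \<Union>k. {w \<in> space ?M. \<exists>p\<in>?K. F e k p w \<le> 0})"
  proof (intro equalityI subsetI)
    fix w assume w: "w \<in> ?G"
    have False if e: "e \<in> ?E" and p: "p \<in> ?K" and F: "F e k p w \<le> 0" for e k p
    proof -
      have "sgn (ip n (fst p) (gvec w j)) = e j" if "j < m" for j
        using F e that unfolding F_zero by (intro h_zero[of _ k]) auto
      then have "V e (fst p) (snd p) w \<le> \<delta>" using w p by (auto simp: V_def)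
      moreover have "0 < 1 / real (Suc k)" by simp
      ultimately show False using F unfolding F_zero by linarith
    qed
    then have "w \<notin> (\<Union>e\<in>?E. \<Union>k. {w \<in> space ?M. \<exists>p\<in>?K. F e k p w \<le> 0})" by blast
    then show "w \<in> space ?M - (\<Union>e\<in>?E. \<Union>k. {w \<in> space ?M. \<exists>p\<in>?K. F e k p w \<le> 0})"
      using w by blast
  next
    fix w assume w: "w \<in> space ?M - (\<Union>e\<in>?E. \<Union>k. {w \<in> space ?M. \<exists>p\<in>?K. F e k p w \<le> 0})"
    show "w \<in> ?G"
    proof (rule ccontr)
      assume "w \<notin> ?G"
      then obtain x y where xy: "x \<in> sparse_sphere n s" "y \<in> sparse_sphere n s" 
        "\<delta> < \<bar>avg m (\<lambda>j. sgn (ip n x (gvec w j)) * ip n y (gvec w j)) - c * ip n x y\<bar>"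
        using w by (auto simp: not_le)
      define e where "e = restrict (\<lambda>j. sgn (ip n x (gvec w j))) {..<m}"
      have e: "e \<in> ?E" by (auto simp: e_def sgn_if)
      have V: "\<delta> < V e x y w" using xy(3) by (simp add: V_def e_def)
      have ev: "\<exists>k. \<forall>k'\<ge>k. 1 / real (Suc k') < a" if a: "a > 0" for a :: real
      proof -
        obtain k where k: "1 / real (Suc k) < a"
          using reals_Archimedean[OF a] by (auto simp: inverse_eq_divide)
        have "1 / real (Suc k') \<le> 1 / real (Suc k)" if "k' \<ge> k" for k'
          using that by (intro divide_left_mono) auto
        then show ?thesis using k by (intro exI[of _ k]) (auto intro: le_less_trans)
      qed
      obtain k0 where k0: "\<forall>k'\<ge>k0. 1 / real (Suc k') < V e x y w - \<delta>" using ev[of "V e x y w - \<delta>"] V by auto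
      have "\<exists>k. \<forall>k'\<ge>k. h (e j) k' (ip n x (gvec w j)) = 0" if "j < m" for j
      proof (cases "ip n x (gvec w j) = 0")
        case True
        then show ?thesis using that by (auto simp: h_def e_def)
      next
        case False
        then obtain k where "\<forall>k'\<ge>k. 1 / real (Suc k') < \<bar>ip n x (gvec w j)\<bar>" using ev[of "\<bar>ip n x (gvec w j)\<bar>"] by auto
        then show ?thesis using that False
          by (intro exI[of _ k]) (auto simp: h_def e_def sgn_if max_def less_imp_le abs_if split: if_splits)
      qed
      then obtain kk where kk: "\<And>j. j < m \<Longrightarrow> \<forall>k'\<ge>kk j. h (e j) k' (ip n x (gvec w j)) = 0" by metis
      \<comment> \<open>One index must serve all \<open>m\<close> rows and the deviation; the sum
        dominates every threshold \<open>kk j\<close>.\<close>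
      define k where "k = k0 + (\<Sum>j<m. kk j)"
      have "kk j \<le> k" if "j < m" for j
        using member_le_sum[of j "{..<m}" kk] that by (simp add: k_def)
      then have "\<forall>j<m. h (e j) k (ip n x (gvec w j)) = 0" using kk by blast
      moreover have "\<delta> + 1 / real (Suc k) \<le> V e x y w"
        using k0[rule_format, of k] by (simp add: k_def)
      ultimately have "F e k (x, y) w \<le> 0" unfolding F_zero by simp
      then have "w \<in> {w \<in> space ?M. \<exists>p\<in>?K. F e k p w \<le> 0}" using w xy(1,2) by blast
      then have "w \<in> (\<Union>e\<in>?E. \<Union>k. {w \<in> space ?M. \<exists>p\<in>?K. F e k p w \<le> 0})" using e by blast
      then show False using w by blast
    qed
  qed
  have "{w \<in> space ?M. \<exists>p\<in>?K. F e k p w \<le> 0} \<in> sets ?M" for e k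
  proof (rule sets_exists_compact_le_zero)
    show "compact ?K" by (intro compact_Times compact_sparse_sphere)
    show "continuous_on ?K (\<lambda>p. F e k p w)" for w
    proof -
      have ic: "continuous_on ?K (\<lambda>p. ip n (f p) v)" if "continuous_on ?K f" for f v
        using that by (intro continuous_on_ip continuous_on_const)
      have hc: "continuous_on ?K (\<lambda>p. h (e j) k (ip n (fst p) (gvec w j)))" for j
        unfolding h_def using ic[OF continuous_on_fst[OF continuous_on_id], of "gvec w j"]
        by (cases "e j = 0")
          (simp_all add: continuous_on_max continuous_on_const continuous_on_diff continuous_on_mult
            continuous_on_rabs)
      have vc: "continuous_on ?K (\<lambda>p. V e (fst p) (snd p) w)"
        unfolding V_def
        by (intro continuous_on_rabs continuous_on_diff continuous_on_mult continuous_on_sum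
            continuous_on_const ic continuous_on_ip continuous_on_fst continuous_on_snd continuous_on_id)
      show ?thesis unfolding F_def
        by (intro continuous_on_add continuous_on_sum continuous_on_max continuous_on_diff
            continuous_on_const hc vc)
    qed
    show "F e k p \<in> borel_measurable ?M" for p
    proof -
      have hm: "(\<lambda>w. h (e j) k (ip n (fst p) (gvec w j))) \<in> borel_measurable ?M" if "j < m" for j
        using measurable_ip_gvec[OF that] unfolding h_def by (cases "e j = 0") auto
      have "(\<lambda>w. V e (fst p) (snd p) w) \<in> borel_measurable ?M"
        unfolding V_def using measurable_ip_gvec
        by (intro borel_measurable_abs borel_measurable_diff borel_measurable_times borel_measurable_const borel_measurable_sum) auto
      then show ?thesis unfolding F_def using hm
        by (intro borel_measurable_add borel_measurable_sum borel_measurable_max borel_measurable_diff borel_measurable_const) auto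
    qed
  qed
  then show ?thesis unfolding eq
    by (intro sets.Diff sets.top sets.finite_UN sets.countable_UN' finite_PiE) auto
qed

subsection \<open>A small net of the sparse sphere\<close>

text \<open>A bound by 2 alone would not pass through the induction. The subtracted term telescopes:
  each of the two new summands is at most the difference of consecutive exponentials, by
  \<open>1 + \<eta> \<le> exp \<eta>\<close>.\<close>

lemma sum_exp_abs_int_le:
  assumes "0 < (\<eta>::real)"
  shows "\<eta> * (\<Sum>j\<in>{- int N..int N}. if j = 0 then 0 else exp (- \<eta> * \<bar>of_int j\<bar>)) \<le> 2 * (1 - exp (- \<eta> * real N))"
proof (induction N)
  case (Suc N)
  have set: "{- int (Suc N)..int (Suc N)} = insert (- int (Suc N)) (insert (int (Suc N)) {- int N..int N})"
    by auto
  let ?e = "exp (- \<eta> * (real N + 1))"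
  have e: "exp (- \<eta> * real N) = ?e * exp \<eta>"
    by (simp add: exp_add[symmetric] algebra_simps)
  have "\<eta> \<le> exp \<eta> - 1" using exp_ge_add_one_self[of \<eta>] by linarith
  then have "\<eta> * ?e \<le> ?e * (exp \<eta> - 1)" by simp
  also have "\<dots> = exp (- \<eta> * real N) - ?e" unfolding e by (simp add: algebra_simps)
  finally have "\<eta> * ?e \<le> exp (- \<eta> * real N) - ?e" .
  then show ?case using Suc.IH unfolding set
    by (simp add: algebra_simps)
qed simp

text \<open>Give every integer vector the product weight with factors \<open>wt\<close>: each point of \<open>P\<close> has weight at
  least \<open>c^s exp (- s)\<close>, while the total weight factorizes over the coordinates.\<close>
lemma card_lattice_points:
  fixes n s N :: nat and \<eta> :: real
  assumes s: "0 < s" "s \<le> n" and \<eta>: "0 < \<eta>" "\<eta> \<le> 1"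
  defines "P \<equiv> {k \<in> PiE {..n} (\<lambda>_. {- int N..int N}).
      (\<Sum>i\<le>n. \<bar>real_of_int (k i)\<bar>) \<le> real s / \<eta> \<and> card {i\<in>{..n}. k i \<noteq> 0} \<le> s}"
  shows "real (card P) \<le> (exp 5 * real n / (real s * \<eta>)) ^ s"
proof -
  \<comment> \<open>This \<open>c\<close> balances the two sides: the nonzero values of one
    coordinate get total weight at most \<open>2 * s / n\<close>, so the n + 1 \<le> 2 n coordinates
    together give at most \<open>exp (4 * s)\<close>. With the factor \<open>exp (- s)\<close> of
    the lower bound this yields \<open>exp 5\<close> per unit of \<open>s\<close>.\<close>
  define c where "c = real s * \<eta> / real n"
  define wt where "wt j = (if j = 0 then 1 else c * exp (- \<eta> * \<bar>real_of_int j\<bar>))" for j :: int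
  have n: "0 < n" using s by simp
  have "real s * \<eta> \<le> real n * 1" using s \<eta> by (intro mult_mono) auto
  then have c: "0 < c" "c \<le> 1" using s \<eta> n by (auto simp: c_def field_simps)
  have wt_nonneg: "0 \<le> wt j" for j using c by (simp add: wt_def)
  have fin: "finite (PiE {..n} (\<lambda>_. {- int N..int N}))" by (intro finite_PiE) auto
  have lower: "c ^ s * exp (- real s) \<le> (\<Prod>i\<le>n. wt (k i))" if k: "k \<in> P" for k
  proof -
    let ?S = "{i\<in>{..n}. k i \<noteq> 0}"
    have "(\<Prod>i\<le>n. wt (k i)) = (\<Prod>i\<le>n. (if k i \<noteq> 0 then c else 1) * exp (- \<eta> * \<bar>real_of_int (k i)\<bar>))"
      by (intro prod.cong) (auto simp: wt_def)
    also have "\<dots> = c ^ card ?S * exp (- \<eta> * (\<Sum>i\<le>n. \<bar>real_of_int (k i)\<bar>))"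
      by (simp add: prod.distrib prod.If_cases exp_sum sum_distrib_left Int_def Collect_conj_eq[symmetric])
    finally have eq: "(\<Prod>i\<le>n. wt (k i)) = c ^ card ?S * exp (- \<eta> * (\<Sum>i\<le>n. \<bar>real_of_int (k i)\<bar>))" .
    have 1: "c ^ s \<le> c ^ card ?S" using k c by (intro power_decreasing) (auto simp: P_def)
    have "\<eta> * (\<Sum>i\<le>n. \<bar>real_of_int (k i)\<bar>) \<le> real s" using k \<eta> by (simp add: P_def field_simps)
    then have 2: "exp (- real s) \<le> exp (- \<eta> * (\<Sum>i\<le>n. \<bar>real_of_int (k i)\<bar>))" by simp
    show ?thesis unfolding eq using 1 2 c by (intro mult_mono) auto
  qed
  let ?G = "\<Sum>j\<in>{- int N..int N}. if j = 0 then 0 else exp (- \<eta> * \<bar>real_of_int j\<bar>)"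
  have "(\<Sum>j\<in>{- int N..int N}. wt j) = (\<Sum>j\<in>{- int N..int N}. (if j = 0 then 1 else 0)
      + c * (if j = 0 then 0 else exp (- \<eta> * \<bar>real_of_int j\<bar>)))"
    by (intro sum.cong) (auto simp: wt_def)
  also have "\<dots> = 1 + c * ?G"
    by (simp add: sum.distrib sum_distrib_left[symmetric])
  also have "c * ?G = (real s / real n) * (\<eta> * ?G)" by (simp add: c_def)
  also have "\<dots> \<le> (real s / real n) * 2"
  proof (intro mult_left_mono)
    have "\<eta> * ?G \<le> 2 * (1 - exp (- \<eta> * real N))" by (rule sum_exp_abs_int_le[OF \<eta>(1)])
    also have "\<dots> \<le> 2" by simp
    finally show "\<eta> * ?G \<le> 2" .
  qed simp
  also have "1 + (real s / real n) * 2 \<le> exp (2 * real s / real n)"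
    using exp_ge_add_one_self[of "2 * real s / real n"] by (simp add: mult.commute)
  finally have row_sum: "(\<Sum>j\<in>{- int N..int N}. wt j) \<le> exp (2 * real s / real n)" by simp
  have "real (card P) * (c ^ s * exp (- real s)) = (\<Sum>k\<in>P. c ^ s * exp (- real s))" by simp
  also have "\<dots> \<le> (\<Sum>k\<in>P. \<Prod>i\<le>n. wt (k i))" by (intro sum_mono lower)
  also have "\<dots> \<le> (\<Sum>k\<in>PiE {..n} (\<lambda>_. {- int N..int N}). \<Prod>i\<le>n. wt (k i))"
    using fin by (intro sum_mono2 prod_nonneg ballI wt_nonneg) (auto simp: P_def)
  also have "\<dots> = (\<Sum>j\<in>{- int N..int N}. wt j) ^ Suc n"
    using prod_sum_PiE[of "{..n}" "\<lambda>_. {- int N..int N}" "\<lambda>_. wt"] by simp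
  also have "\<dots> \<le> exp (2 * real s / real n) ^ Suc n"
    by (intro power_mono row_sum sum_nonneg wt_nonneg)
  also have "\<dots> = exp (real (Suc n) * (2 * real s / real n))" by (simp only: exp_of_nat_mult)
  also have "\<dots> \<le> exp (4 * real s)"
  proof -
    have "real s * real (Suc n) \<le> real s * (2 * real n)" using n by (intro mult_left_mono) auto
    then show ?thesis using n by (simp add: field_simps)
  qed
  finally have *: "real (card P) * (c ^ s * exp (- real s)) \<le> exp (4 * real s)" .
  have "real (card P) \<le> exp (4 * real s) / (c ^ s * exp (- real s))"
    using * c by (simp add: pos_le_divide_eq)
  also have "\<dots> = exp (real s * 5) / c ^ s"
  proof -
    have "exp (real s * 5) * exp (- real s) = exp (4 * real s)" by (simp add: exp_add[symmetric])
    then show ?thesis using c by (simp add: field_simps)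
  qed
  also have "\<dots> = (exp 5 / c) ^ s" by (simp add: power_divide exp_of_nat_mult)
  also have "exp 5 / c = exp 5 * real n / (real s * \<eta>)" by (simp add: c_def)
  finally show ?thesis .
qed

abbreviation nrm :: "nat \<Rightarrow> (nat \<Rightarrow> real) \<Rightarrow> real" where "nrm n x \<equiv> L2_set x {..n}"

lemma nrm_ip: "(nrm n x)\<^sup>2 = ip n x x"
  by (simp add: L2_set_def ip_def power2_eq_square sum_nonneg)

lemma nrm_sparse_sphere: "x \<in> sparse_sphere n s \<Longrightarrow> nrm n x = 1"
  by (simp add: sparse_sphere_def L2_set_def)

text \<open>Round \<open>x\<close> to the grid of step \<open>\<eta> / sqrt s\<close> and normalize.
  At most \<open>s\<close> coordinates are off the grid, so rounding moves \<open>x\<close> by at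
  most \<open>\<eta>\<close>, and so does normalizing. By Cauchy-Schwarz the l1 norm of
  \<open>x\<close> is at most \<open>sqrt s\<close>, which places the integer vector in the set
  counted by \<open>card_lattice_points\<close>.\<close>

lemma sparse_sphere_net:
  fixes n s :: nat and \<eta> :: real
  assumes s: "0 < s" "s \<le> n" and \<eta>: "0 < \<eta>" "\<eta> < 1"
  obtains N where "finite N" "N \<subseteq> sparse_sphere n s"
    "real (card N) \<le> (exp 5 * real n / (real s * \<eta>)) ^ s"
    "\<forall>x\<in>sparse_sphere n s.
       \<exists>u\<in>N. (\<forall>i. x i = 0 \<longrightarrow> u i = 0) \<and> nrm n (\<lambda>i. x i - u i) \<le> 2 * \<eta>"
proof -
  define q where "q = sqrt (real s) / \<eta>"
  define B where "B = nat \<lfloor>real s / \<eta>\<rfloor>"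
  define P where "P = {k \<in> PiE {..n} (\<lambda>_. {- int B..int B}).
      (\<Sum>i\<le>n. \<bar>real_of_int (k i)\<bar>) \<le> real s / \<eta> \<and> card {i\<in>{..n}. k i \<noteq> 0} \<le> s}"
  define nv where "nv k i = (if i \<le> n then real_of_int (k i) / nrm n (\<lambda>i. real_of_int (k i)) else 0)"
    for k :: "nat \<Rightarrow> int" and i
  \<comment> \<open>The zero lattice point has no normalization; since \<open>0 / 0 = 0\<close> it
    is sent to the zero vector, which the intersection removes.\<close>
  define N where "N = nv ` P \<inter> sparse_sphere n s"
  have q: "0 < q" using s \<eta> by (simp add: q_def)
  have finP: "finite P" unfolding P_def by (rule finite_subset[of _ "PiE {..n} (\<lambda>_. {- int B..int B})"]) (auto intro!: finite_PiE)
  have finN: "finite N" using finP by (simp add: N_def)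
  have "card N \<le> card (nv ` P)" using finP by (intro card_mono) (auto simp: N_def)
  also have "\<dots> \<le> card P" by (rule card_image_le[OF finP])
  finally have "real (card N) \<le> real (card P)" by simp
  also have "\<dots> \<le> (exp 5 * real n / (real s * \<eta>)) ^ s"
    unfolding P_def using s \<eta> by (intro card_lattice_points) auto
  finally have cardN: "real (card N) \<le> (exp 5 * real n / (real s * \<eta>)) ^ s" .
  have "\<exists>u\<in>N. (\<forall>i. x i = 0 \<longrightarrow> u i = 0) \<and> nrm n (\<lambda>i. x i - u i) \<le> 2 * \<eta>"
    if x: "x \<in> sparse_sphere n s" for x
  proof -
    let ?S = "{i\<in>{..n}. x i \<noteq> 0}"
    \<comment> \<open>Truncation towards zero rather than \<open>floor\<close>: absolute values must
      not grow, so that the l1 bound passes to the integer vector.\<close>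
    define t where "t i = (if 0 \<le> x i then \<lfloor>x i * q\<rfloor> else - \<lfloor>- x i * q\<rfloor>)" for i
    define k where "k = restrict t {..n}"
    define z where "z i = real_of_int (t i) / q" for i
    have cS: "card ?S \<le> s" using x by (simp add: sparse_sphere_iff)
    have nx: "nrm n x = 1" using x by (rule nrm_sparse_sphere)
    have t0: "x i = 0 \<Longrightarrow> t i = 0" for i by (simp add: t_def)
    have tle: "\<bar>real_of_int (t i)\<bar> \<le> \<bar>x i\<bar> * q" for i
    proof (cases "0 \<le> x i")
      case True
      then have "0 \<le> x i * q" using q by simp
      then show ?thesis using True by (simp add: t_def)
    next
      case False
      then have "0 \<le> - x i * q" using q by (simp add: mult_nonpos_nonneg)
      then have "0 \<le> \<lfloor>- x i * q\<rfloor>" by simp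
      moreover have "real_of_int \<lfloor>- x i * q\<rfloor> \<le> - x i * q" by (rule of_int_floor_le)
      ultimately show ?thesis using False by (simp add: t_def)
    qed
    have terr: "\<bar>x i * q - real_of_int (t i)\<bar> \<le> 1" for i
      unfolding t_def by (auto; linarith)
    have abs1: "(\<Sum>i\<le>n. \<bar>x i\<bar>) \<le> sqrt (real s)"
    proof -
      have "(\<Sum>i\<le>n. \<bar>x i\<bar>) = (\<Sum>i\<le>n. \<bar>x i\<bar> * \<bar>if x i \<noteq> 0 then 1 else 0\<bar>)" by (intro sum.cong) auto
      also have "\<dots> \<le> nrm n x * nrm n (\<lambda>i. if x i \<noteq> 0 then 1 else 0)" by (rule L2_set_mult_ineq)
      also have "nrm n (\<lambda>i. if x i \<noteq> 0 then 1 else 0) = sqrt (real (card ?S))"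
        by (simp add: L2_set_def if_distrib[of "\<lambda>x. x\<^sup>2"] sum.If_cases Int_def Collect_conj_eq[symmetric] cong: if_cong)
      also have "nrm n x * sqrt (real (card ?S)) \<le> sqrt (real s)" using cS nx by simp
      finally show ?thesis .
    qed
    have sumk: "(\<Sum>i\<le>n. \<bar>real_of_int (t i)\<bar>) \<le> real s / \<eta>"
    proof -
      have "(\<Sum>i\<le>n. \<bar>real_of_int (t i)\<bar>) \<le> (\<Sum>i\<le>n. \<bar>x i\<bar> * q)" by (intro sum_mono tle)
      also have "\<dots> = (\<Sum>i\<le>n. \<bar>x i\<bar>) * q" by (simp add: sum_distrib_right)
      also have "\<dots> \<le> sqrt (real s) * q" using q abs1 by (intro mult_right_mono) auto
      also have "\<dots> = real s / \<eta>" by (simp add: q_def)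
      finally show ?thesis .
    qed
    have kP: "k \<in> P"
    proof -
      have "t i \<in> {- int B..int B}" if "i \<le> n" for i
      proof -
        have "\<bar>real_of_int (t i)\<bar> \<le> (\<Sum>i\<le>n. \<bar>real_of_int (t i)\<bar>)"
          using that by (intro member_le_sum) auto
        also note sumk
        finally have "\<bar>t i\<bar> \<le> \<lfloor>real s / \<eta>\<rfloor>" by (simp add: le_floor_iff)
        then show ?thesis using \<eta> by (auto simp: B_def)
      qed
      moreover have "card {i\<in>{..n}. k i \<noteq> 0} \<le> card ?S"
        by (intro card_mono) (auto simp: k_def t0)
      ultimately show ?thesis using sumk cS by (auto simp: P_def k_def)
    qed
    have err: "nrm n (\<lambda>i. x i - z i) \<le> \<eta>"
    proof -
      have "(\<Sum>i\<le>n. (x i - z i)\<^sup>2) \<le> (\<Sum>i\<le>n. if x i \<noteq> 0 then (1 / q)\<^sup>2 else 0)"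
      proof (intro sum_mono)
        fix i
        have "x i - z i = (x i * q - real_of_int (t i)) / q" using q by (simp add: z_def field_simps)
        then have "\<bar>x i - z i\<bar> \<le> 1 / q" using terr[of i] q by (simp add: divide_right_mono)
        then have "(x i - z i)\<^sup>2 \<le> (1 / q)\<^sup>2" using q by (intro power2_le_iff_abs_le[THEN iffD2]) auto
        then show "(x i - z i)\<^sup>2 \<le> (if x i \<noteq> 0 then (1 / q)\<^sup>2 else 0)" by (auto simp: z_def t0)
      qed
      also have "\<dots> = real (card ?S) * (1 / q)\<^sup>2"
        by (simp add: sum.If_cases Int_def Collect_conj_eq[symmetric])
      also have "\<dots> \<le> real s * (1 / q)\<^sup>2" using cS by (intro mult_right_mono) auto
      also have "\<dots> = \<eta>\<^sup>2" using s \<eta> by (simp add: q_def power_divide)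
      finally show ?thesis unfolding L2_set_def using \<eta> by (intro real_le_lsqrt) auto
    qed
    have tri: "\<bar>nrm n x - nrm n z\<bar> \<le> nrm n (\<lambda>i. x i - z i)"
    proof -
      have "nrm n x \<le> nrm n (\<lambda>i. x i - z i) + nrm n z"
        using L2_set_triangle_ineq[of "\<lambda>i. x i - z i" z "{..n}"] by simp
      moreover have "nrm n z \<le> nrm n (\<lambda>i. z i - x i) + nrm n x"
        using L2_set_triangle_ineq[of "\<lambda>i. z i - x i" x "{..n}"] by simp
      moreover have "nrm n (\<lambda>i. z i - x i) = nrm n (\<lambda>i. x i - z i)"
        by (simp add: L2_set_def power2_commute)
      ultimately show ?thesis by linarith
    qed
    define r where "r = nrm n z"
    have r: "\<bar>1 - r\<bar> \<le> \<eta>" using tri err nx by (simp add: r_def)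
    then have r0: "0 < r" using \<eta> by linarith
    have nk: "nrm n (\<lambda>i. real_of_int (k i)) = q * r"
    proof -
      have "nrm n (\<lambda>i. real_of_int (k i)) = nrm n (\<lambda>i. q * z i)"
        using q by (intro L2_set_cong) (auto simp: k_def z_def)
      also have "\<dots> = q * r" unfolding r_def using q by (subst L2_set_right_distrib) auto
      finally show ?thesis .
    qed
    have nvk: "nv k i = z i / r" if "i \<le> n" for i
      using that q nk by (simp add: nv_def z_def k_def)
    have nnv: "nrm n (nv k) = 1"
    proof -
      have "nrm n (nv k) = nrm n (\<lambda>i. (1 / r) * z i)" by (intro L2_set_cong) (auto simp: nvk)
      also have "\<dots> = (1 / r) * r" using r0 L2_set_right_distrib[of "1/r" z "{..n}"] by (simp add: r_def)
      finally show ?thesis using r0 by simp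
    qed
    have supp: "x i = 0 \<Longrightarrow> nv k i = 0" for i
      by (cases "i \<le> n") (simp add: nvk z_def t0, simp add: nv_def)
    have "card {i\<in>{..n}. nv k i \<noteq> 0} \<le> card ?S" using supp by (intro card_mono) auto
    then have "nv k \<in> sparse_sphere n s"
      using nnv cS nrm_ip[of "nv k" n] by (auto simp: sparse_sphere_iff nv_def)
    then have "nv k \<in> N" using kP by (simp add: N_def)
    moreover have "nrm n (\<lambda>i. x i - nv k i) \<le> 2 * \<eta>"
    proof -
      have "nrm n (\<lambda>i. z i - nv k i) = nrm n (\<lambda>i. (1 - 1 / r) * z i)"
        by (intro L2_set_cong) (auto simp: nvk algebra_simps)
      also have "\<dots> = sqrt (\<Sum>i\<le>n. (1 - 1 / r)\<^sup>2 * (z i)\<^sup>2)" by (simp add: L2_set_def power_mult_distrib)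
      also have "\<dots> = \<bar>1 - 1 / r\<bar> * r" unfolding r_def L2_set_def
        by (simp only: sum_distrib_left[symmetric] real_sqrt_mult real_sqrt_abs)
      also have "\<dots> = \<bar>(1 - 1 / r) * r\<bar>" using r0 by (simp add: abs_mult)
      also have "(1 - 1 / r) * r = r - 1" using r0 by (simp add: field_simps)
      finally have "nrm n (\<lambda>i. z i - nv k i) \<le> \<eta>" using r by simp
      moreover have "nrm n (\<lambda>i. x i - nv k i) \<le> nrm n (\<lambda>i. x i - z i) + nrm n (\<lambda>i. z i - nv k i)"
        using L2_set_triangle_ineq[of "\<lambda>i. x i - z i" "\<lambda>i. z i - nv k i" "{..n}"] by simp
      ultimately show ?thesis using err by linarith
    qed
    ultimately show ?thesis using supp by blast
  qed
  then show ?thesis by (intro that[OF finN _ cardN] ballI) (auto simp: N_def)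
qed

subsection \<open>Rows of a gaussian matrix\<close>

lemma prob_space_std_normal_measure: "prob_space std_normal_measure"
  unfolding std_normal_measure_def by (rule prob_space_normal_density) simp

lemma prob_space_gauss_space: "prob_space (gauss_space m n)"
  unfolding gauss_space_def by (intro prob_space_PiM prob_space_std_normal_measure)

lemma distributed_entry:
  assumes "j < m" "i \<le> n"
  shows "distributed (gauss_space m n) lborel (\<lambda>w. w (j, i)) std_normal_density"
proof -
  have "distr (gauss_space m n) std_normal_measure (\<lambda>w. w (j, i)) = std_normal_measure"
    unfolding gauss_space_def using assms prob_space_std_normal_measure
    by (intro distr_PiM_component) auto
  moreover have "distr (gauss_space m n) std_normal_measure (\<lambda>w. w (j, i)) = distr (gauss_space m n) lborel (\<lambda>w. w (j, i))"
    by (intro distr_cong) (auto simp: std_normal_measure_def)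
  ultimately show ?thesis
    using measurable_entry[OF assms] by (auto simp: distributed_def std_normal_measure_def)
qed

text \<open>The joint law of the coordinate maps of a product space is the product of their laws.
  The characterization of independence by this identity asks for a nonempty index set, hence the
  separate case \<open>m = 0\<close>.\<close>

lemma indep_entries:
  "prob_space.indep_vars (gauss_space m n) (\<lambda>_. borel) (\<lambda>p w. w p) ({..<m} \<times> {..n})"
proof -
  interpret prob_space "gauss_space m n" by (rule prob_space_gauss_space)
  show ?thesis
  proof (cases "m = 0")
    case True
    then show ?thesis unfolding indep_vars_def indep_sets_def by auto
  next
    case False
    have rv: "random_variable borel (\<lambda>w. w p)" if "p \<in> {..<m} \<times> {..n}" for p
      using that measurable_entry[of "fst p" m "snd p" n] by auto
    have "distr (gauss_space m n) (PiM ({..<m} \<times> {..n}) (\<lambda>_. borel)) (\<lambda>w. \<lambda>p\<in>{..<m} \<times> {..n}. w p)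
        = distr (gauss_space m n) (gauss_space m n) (\<lambda>w. w)"
      by (intro distr_cong) (auto simp: gauss_space_def std_normal_measure_def space_PiM PiE_restrict intro!: sets_PiM_cong)
    also have "\<dots> = gauss_space m n" by (rule distr_id)
    also have "\<dots> = PiM ({..<m} \<times> {..n}) (\<lambda>p. distr (gauss_space m n) borel (\<lambda>w. w p))"
      unfolding gauss_space_def
    proof (intro PiM_cong refl)
      fix p assume p: "p \<in> {..<m} \<times> {..n}"
      have "distr (PiM ({..<m} \<times> {..n}) (\<lambda>_. std_normal_measure)) std_normal_measure (\<lambda>w. w p) = std_normal_measure"
        using p prob_space_std_normal_measure by (intro distr_PiM_component) auto
      moreover have "distr (PiM ({..<m} \<times> {..n}) (\<lambda>_. std_normal_measure)) std_normal_measure (\<lambda>w. w p) =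
        distr (PiM ({..<m} \<times> {..n}) (\<lambda>_. std_normal_measure)) borel (\<lambda>w. w p)"
        by (intro distr_cong) (auto simp: std_normal_measure_def)
      ultimately show "std_normal_measure = distr (PiM ({..<m} \<times> {..n}) (\<lambda>_. std_normal_measure)) borel (\<lambda>w. w p)"
        by simp
    qed
    finally show ?thesis
      using False by (intro indep_vars_iff_distr_eq_PiM'[THEN iffD2] rv) auto
  qed
qed

lemma distributed_ip_gvec:
  assumes j: "j < m" and x: "ip n x x = \<sigma>\<^sup>2" and \<sigma>: "0 < \<sigma>"
  shows "distributed (gauss_space m n) lborel (\<lambda>w. ip n x (gvec w j)) (normal_density 0 \<sigma>)"
proof -
  interpret prob_space "gauss_space m n" by (rule prob_space_gauss_space)
  \<comment> \<open>\<open>sum_indep_normal\<close> requires positive standard deviations and a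
    nonempty index set, so the sum is cut down to the support of \<open>x\<close>.\<close>
  define S where "S = {i. i \<le> n \<and> x i \<noteq> 0}"
  have finS: "finite S" by (simp add: S_def)
  have sum_S: "(\<Sum>i\<le>n. x i * f i) = (\<Sum>i\<in>S. x i * f i)" for f :: "nat \<Rightarrow> real"
    by (rule sum.mono_neutral_right) (auto simp: S_def)
  have neS: "S \<noteq> {}"
  proof
    assume "S = {}"
    then have "ip n x x = 0" using sum_S[of x] by (simp add: ip_def)
    then show False using x \<sigma> by simp
  qed
  let ?I = "Pair j ` S"
  have reindex: "(\<Sum>p\<in>?I. g p) = (\<Sum>i\<in>S. g (j, i))" for g :: "nat \<times> nat \<Rightarrow> real"
    by (simp add: sum.reindex inj_on_def)
  have "indep_vars (\<lambda>_. borel) (\<lambda>p w. w p) ?I"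
    using j by (intro indep_vars_subset[OF indep_entries]) (auto simp: S_def)
  then have ind: "indep_vars (\<lambda>_. borel) (\<lambda>p w. x (snd p) * w p) ?I"
    by (rule indep_vars_compose2[where Y = "\<lambda>p u. x (snd p) * u"]) auto
  have "distributed (gauss_space m n) lborel (\<lambda>w. \<Sum>p\<in>?I. x (snd p) * w p)
      (normal_density (\<Sum>p\<in>?I. 0) (sqrt (\<Sum>p\<in>?I. \<bar>x (snd p)\<bar>\<^sup>2)))"
  proof (rule sum_indep_normal[OF _ _ ind])
    fix p assume "p \<in> ?I"
    then obtain i where i: "p = (j, i)" "i \<le> n" "x i \<noteq> 0" by (auto simp: S_def)
    show "0 < \<bar>x (snd p)\<bar>" using i by simp
    show "distributed (gauss_space m n) lborel (\<lambda>w. x (snd p) * w p) (normal_density 0 \<bar>x (snd p)\<bar>)"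
      using normal_density_affine[OF distributed_entry[OF j i(2)], of "x i" 0] i by simp
  qed (use finS neS in auto)
  moreover have "(\<Sum>p\<in>?I. \<bar>x (snd p)\<bar>\<^sup>2) = \<sigma>\<^sup>2"
    using x sum_S[of x] by (simp add: reindex ip_def power2_eq_square)
  moreover have "ip n x (gvec w j) = (\<Sum>p\<in>?I. x (snd p) * w p)" for w
    using sum_S[of "gvec w j"] by (simp add: reindex ip_def gvec_def)
  ultimately show ?thesis using \<sigma> by simp
qed

lemma ip_cong: "(\<And>i. i \<le> n \<Longrightarrow> v i = v' i) \<Longrightarrow> ip n x v = ip n x v'"
  by (simp add: ip_def)

text \<open>Entries are grouped by row, and functions of disjoint groups are independent. A general
  \<open>f\<close> of the two products lets one statement serve the deviations, the squares and the
  counts.\<close>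

lemma indep_rows:
  assumes f: "(\<lambda>(u, v). f u v) \<in> borel_measurable (borel \<Otimes>\<^sub>M borel)"
  shows "prob_space.indep_vars (gauss_space m n) (\<lambda>_. borel)
     (\<lambda>j w. f (ip n x (gvec w j)) (ip n y (gvec w j)) :: real) {..<m}"
proof -
  interpret prob_space "gauss_space m n" by (rule prob_space_gauss_space)
  have f' [measurable]: "(\<lambda>w. f (g w) (h w)) \<in> borel_measurable M"
    if "g \<in> borel_measurable M" "h \<in> borel_measurable M" for g h M
    using measurable_compose[OF measurable_Pair[OF that] f] by simp
  have 1: "indep_vars (\<lambda>j. PiM ({j} \<times> {..n}) (\<lambda>_. borel)) (\<lambda>j w. restrict (\<lambda>p. w p) ({j} \<times> {..n})) {..<m}"
    by (rule indep_vars_restrict[OF indep_entries]) (auto simp: disjoint_family_on_def)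
  have m: "(\<lambda>w. ip n x (gvec w j)) \<in> borel_measurable (PiM ({j} \<times> {..n}) (\<lambda>_. borel))" for x j
    unfolding ip_def gvec_def
    by (intro borel_measurable_sum borel_measurable_times borel_measurable_const measurable_component_singleton) auto
  have "indep_vars (\<lambda>_. borel) (\<lambda>j w. f (ip n x (gvec (restrict (\<lambda>p. w p) ({j} \<times> {..n})) j))
      (ip n y (gvec (restrict (\<lambda>p. w p) ({j} \<times> {..n})) j))) {..<m}"
    by (rule indep_vars_compose2[OF 1]) (intro f' m)
  moreover have "ip n x (gvec (restrict (\<lambda>p. w p) ({j} \<times> {..n})) j) = ip n x (gvec w j)" for x w j
    by (rule ip_cong) (simp add: gvec_def)
  ultimately show ?thesis by simp
qed

section \<open>Chernoff bound for sums over rows, and the exponential moments it is applied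
  to\<close>

lemma chernoff_rows:
  assumes f: "(\<lambda>(u, v). f u v) \<in> borel_measurable (borel \<Otimes>\<^sub>M borel)"
    and b: "\<And>j. j < m \<Longrightarrow> (\<integral>\<^sup>+w. ennreal (exp (f (ip n x (gvec w j)) (ip n y (gvec w j)))) \<partial>gauss_space m n) \<le> ennreal (exp b)"
  shows "measure (gauss_space m n) {w \<in> space (gauss_space m n). real m * a \<le> (\<Sum>j<m. f (ip n x (gvec w j)) (ip n y (gvec w j)))}
     \<le> exp (real m * (b - a))"
proof -
  interpret prob_space "gauss_space m n" by (rule prob_space_gauss_space)
  let ?M = "gauss_space m n"
  let ?X = "\<lambda>j w. f (ip n x (gvec w j)) (ip n y (gvec w j))"
  have rv: "random_variable borel (?X j)" if "j < m" for j
    using indep_rows[OF f, of m n x y] that unfolding indep_vars_def by auto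
  then have rvs: "random_variable borel (\<lambda>w. \<Sum>j<m. ?X j w)" by (intro borel_measurable_sum) auto
  have "indep_vars (\<lambda>_. borel) (\<lambda>j w. exp (?X j w)) {..<m}"
    by (rule indep_vars_compose2[OF indep_rows[OF f]]) auto
  then have "indep_vars (\<lambda>_. borel) (\<lambda>j w. ennreal (exp (?X j w))) {..<m}"
    by (rule indep_vars_compose2) auto
  then have prod: "(\<integral>\<^sup>+w. (\<Prod>j<m. ennreal (exp (?X j w))) \<partial>?M) = (\<Prod>j<m. \<integral>\<^sup>+w. ennreal (exp (?X j w)) \<partial>?M)"
    by (intro indep_vars_nn_integral) auto
  \<comment> \<open>The Chernoff parameter is 1 because callers put their own parameter into
    \<open>f\<close>. Nonnegative integrals avoid any integrability condition on the
    exponentials.\<close>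
  have "emeasure ?M {w \<in> space ?M. real m * a \<le> (\<Sum>j<m. ?X j w)} \<le>
      ennreal (exp (-1 * (real m * a))) * (\<integral>\<^sup>+w. ennreal (exp (1 * (\<Sum>j<m. ?X j w))) * indicator (space ?M) w \<partial>?M)"
    using rvs by (intro Chernoff_ineq_nn_integral_ge) auto
  also have "(\<integral>\<^sup>+w. ennreal (exp (1 * (\<Sum>j<m. ?X j w))) * indicator (space ?M) w \<partial>?M)
      = (\<integral>\<^sup>+w. (\<Prod>j<m. ennreal (exp (?X j w))) \<partial>?M)"
    by (intro nn_integral_cong) (simp add: exp_sum prod_ennreal)
  also have "\<dots> \<le> (\<Prod>j<m. ennreal (exp b))" unfolding prod using b by (intro prod_mono_ennreal) auto
  also have "\<dots> = ennreal (exp (real m * b))" by (simp add: ennreal_power exp_of_nat_mult)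
  also have "ennreal (exp (-1 * (real m * a))) * ennreal (exp (real m * b)) = ennreal (exp (real m * (b - a)))"
    by (simp add: ennreal_mult'[symmetric] exp_add[symmetric] algebra_simps)
  finally have "emeasure ?M {w \<in> space ?M. real m * a \<le> (\<Sum>j<m. ?X j w)} \<le> ennreal (exp (real m * (b - a)))"
    by (simp add: mult_left_mono)
  then show ?thesis by (simp add: emeasure_eq_measure)
qed

text \<open>Turns an exponential moment of a square into a subgaussian bound for a centred variable:
  on taking expectations the linear term vanishes, and no Taylor series of moments is
  needed.\<close>

lemma exp_le_self_plus_exp_square: "exp w \<le> w + exp (w\<^sup>2)" for w :: real
proof -
  have sq: "1 + w\<^sup>2 \<le> exp (w\<^sup>2)" by (rule exp_ge_add_one_self)
  consider "1 \<le> w" | "0 \<le> w" "w \<le> 1" | "-1 \<le> w" "w \<le> 0" | "w \<le> -1" by linarith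
  then show ?thesis
  proof cases
    case 1
    then have "w \<le> w\<^sup>2" by (simp add: power2_eq_square)
    then have "exp w \<le> exp (w\<^sup>2)" by simp
    then show ?thesis using 1 by linarith
  next
    case 2
    then show ?thesis using exp_bound[of w] sq by linarith
  next
    case 3
    define u where "u = - w"
    have u: "0 \<le> u" using 3 by (simp add: u_def)
    have "exp (- u) = 1 / exp u" by (simp add: exp_minus inverse_eq_divide)
    also have "\<dots> \<le> 1 / (1 + u)" using u exp_ge_add_one_self[of u] by (intro divide_left_mono) auto
    also have "\<dots> \<le> 1 - u + u\<^sup>2"
    proof -
      have "1 \<le> 1 + u ^ 3" using u by simp
      also have "\<dots> = (1 - u + u\<^sup>2) * (1 + u)" by (simp add: algebra_simps power2_eq_square power3_eq_cube)
      finally show ?thesis using u by (simp add: pos_divide_le_eq)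
    qed
    finally have "exp w \<le> 1 + w + w\<^sup>2" by (simp add: u_def)
    then show ?thesis using sq by linarith
  next
    case 4
    then have "0 \<le> w * (w + 1)" by (intro mult_nonpos_nonpos) auto
    then have "0 \<le> w\<^sup>2 + w" by (simp add: power2_eq_square algebra_simps)
    moreover have "exp w \<le> 1" using 4 by simp
    ultimately show ?thesis using sq by linarith
  qed
qed

text \<open>For \<open>q = 2 * a\<close> the left side is the exponential moment of \<open>a\<close>
  times a squared standard gaussian. After squaring, \<open>1 \<le> (1 - q) * (1 + 2 * q)\<close> is
  enough.\<close>

lemma inverse_sqrt_le_exp:
  assumes "0 \<le> (q::real)" "q \<le> 1 / 2"
  shows "1 / sqrt (1 - q) \<le> exp q"
proof -
  have "1 \<le> (1 - q) * (1 + 2 * q)"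
  proof -
    have "0 \<le> q * (1 - 2 * q)" using assms by (intro mult_nonneg_nonneg) auto
    then show ?thesis by (simp add: algebra_simps)
  qed
  also have "\<dots> \<le> (1 - q) * exp (2 * q)"
    using assms exp_ge_add_one_self[of "2 * q"] by (intro mult_left_mono) auto
  also have "\<dots> = (1 - q) * (exp q)\<^sup>2" by (simp add: exp_double)
  finally have "sqrt 1 \<le> sqrt ((1 - q) * (exp q)\<^sup>2)" by (rule real_sqrt_le_mono)
  then have "1 \<le> sqrt (1 - q) * exp q" by (simp add: real_sqrt_mult)
  then show ?thesis using assms by (simp add: pos_divide_le_eq mult.commute)
qed

text \<open>Multiplying the standard normal density by \<open>exp (a * v\<^sup>2)\<close> gives
  \<open>\<sigma>\<close> times the centred normal density with variance
  \<open>1 / (1 - 2 * a)\<close>, so the integral equals \<open>\<sigma>\<close>. The bound 1/4 on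
  \<open>a\<close> is the range of \<open>inverse_sqrt_le_exp\<close>.\<close>

lemma nn_integral_exp_square:
  assumes j: "j < m" and y: "ip n y y = 1" and a: "0 \<le> a" "a \<le> 1 / 4"
  shows "(\<integral>\<^sup>+w. ennreal (exp (a * (ip n y (gvec w j))\<^sup>2)) \<partial>gauss_space m n) \<le> ennreal (exp (2 * a))"
proof -
  have D: "distributed (gauss_space m n) lborel (\<lambda>w. ip n y (gvec w j)) std_normal_density"
    using distributed_ip_gvec[OF j, of n y 1] y by simp
  define \<sigma> where "\<sigma> = 1 / sqrt (1 - 2 * a)"
  have s: "0 < \<sigma>" using a by (simp add: \<sigma>_def)
  have s2: "1 / \<sigma>\<^sup>2 = 1 - 2 * a" using a by (simp add: \<sigma>_def power_divide)
  have "(\<integral>\<^sup>+w. ennreal (exp (a * (ip n y (gvec w j))\<^sup>2)) \<partial>gauss_space m n) =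
      (\<integral>\<^sup>+v. ennreal (std_normal_density v) * ennreal (exp (a * v\<^sup>2)) \<partial>lborel)"
    by (rule distributed_nn_integral[OF D, symmetric]) simp
  also have "\<dots> = (\<integral>\<^sup>+v. ennreal \<sigma> * ennreal (normal_density 0 \<sigma> v) \<partial>lborel)"
  proof (intro nn_integral_cong)
    fix v :: real
    have "- v\<^sup>2 / 2 + a * v\<^sup>2 = - (v\<^sup>2 / 2 * (1 - 2 * a))" by (simp add: field_simps)
    also have "\<dots> = - (v - 0)\<^sup>2 / (2 * \<sigma>\<^sup>2)" unfolding s2[symmetric] by simp
    finally have E: "exp (- v\<^sup>2 / 2) * exp (a * v\<^sup>2) = exp (- (v - 0)\<^sup>2 / (2 * \<sigma>\<^sup>2))"
      by (simp add: exp_add[symmetric])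
    have S: "1 / sqrt (2 * pi) = \<sigma> * (1 / sqrt (2 * pi * \<sigma>\<^sup>2))" using s by (simp add: real_sqrt_mult)
    have "std_normal_density v * exp (a * v\<^sup>2) = 1 / sqrt (2 * pi) * (exp (- v\<^sup>2 / 2) * exp (a * v\<^sup>2))"
      by (simp add: std_normal_density_def)
    also have "\<dots> = \<sigma> * normal_density 0 \<sigma> v"
      unfolding E S by (simp add: normal_density_def)
    finally have "std_normal_density v * exp (a * v\<^sup>2) = \<sigma> * normal_density 0 \<sigma> v" .
    then show "ennreal (std_normal_density v) * ennreal (exp (a * v\<^sup>2)) = ennreal \<sigma> * ennreal (normal_density 0 \<sigma> v)"
      using s by (simp add: ennreal_mult'[symmetric])
  qed
  also have "\<dots> = ennreal \<sigma> * (\<integral>\<^sup>+v. ennreal (normal_density 0 \<sigma> v) \<partial>lborel)"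
    by (rule nn_integral_cmult) simp
  also have "(\<integral>\<^sup>+v. ennreal (normal_density 0 \<sigma> v) \<partial>lborel) = 1"
    using s by (subst nn_integral_eq_integral) auto
  finally show ?thesis using inverse_sqrt_le_exp[of "2 * a"] a by (simp add: \<sigma>_def ennreal_leI)
qed

text \<open>On the interval the exponential adds at most (3 - 1) times a density of at most 1/2,
  that is at most 1 per unit of length; the interval has length \<open>2 * t\<close>.\<close>

lemma nn_integral_exp_indicator:
  assumes j: "j < m" and x: "ip n x x = 1" and t: "0 \<le> t"
  shows "(\<integral>\<^sup>+w. ennreal (exp (indicator {-t..t} (ip n x (gvec w j)))) \<partial>gauss_space m n) \<le> ennreal (exp (2 * t))"
proof -
  have D: "distributed (gauss_space m n) lborel (\<lambda>w. ip n x (gvec w j)) std_normal_density"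
    using distributed_ip_gvec[OF j, of n x 1] x by simp
  have e: "exp (1::real) \<le> 3" by (rule exp_le)
  have dens: "std_normal_density v \<le> 1 / 2" for v
  proof -
    have "sqrt 4 \<le> sqrt (2 * pi)" using pi_gt3 by (intro real_sqrt_le_mono) simp
    then have "1 / sqrt (2 * pi) \<le> 1 / 2" by (intro divide_left_mono) auto
    moreover have "exp (- v\<^sup>2 / 2) \<le> 1" by simp
    ultimately have "1 / sqrt (2 * pi) * exp (- v\<^sup>2 / 2) \<le> 1 / 2 * 1" by (intro mult_mono) auto
    then show ?thesis by (simp add: std_normal_density_def)
  qed
  have "(\<integral>\<^sup>+w. ennreal (exp (indicator {-t..t} (ip n x (gvec w j)))) \<partial>gauss_space m n) =
      (\<integral>\<^sup>+v. ennreal (std_normal_density v) * ennreal (exp (indicator {-t..t} v)) \<partial>lborel)"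
    by (rule distributed_nn_integral[OF D, symmetric]) simp
  also have "\<dots> \<le> (\<integral>\<^sup>+v. ennreal (std_normal_density v) + indicator {-t..t} v \<partial>lborel)"
  proof (intro nn_integral_mono)
    fix v
    have "std_normal_density v * exp (indicator {-t..t} v) \<le> std_normal_density v + indicator {-t..t} v"
    proof (cases "v \<in> {-t..t}")
      case True
      have "std_normal_density v * exp 1 \<le> std_normal_density v * 3" using e by (intro mult_left_mono) auto
      then show ?thesis using True dens[of v] by simp
    qed simp
    then have "ennreal (std_normal_density v * exp (indicator {-t..t} v)) \<le> ennreal (std_normal_density v + indicator {-t..t} v)"
      by (rule ennreal_leI)
    then show "ennreal (std_normal_density v) * ennreal (exp (indicator {-t..t} v)) \<le> ennreal (std_normal_density v) + indicator {-t..t} v"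
      by (simp add: ennreal_mult' ennreal_plus ennreal_indicator)
  qed
  also have "\<dots> = (\<integral>\<^sup>+v. ennreal (std_normal_density v) \<partial>lborel) + (\<integral>\<^sup>+v. indicator {-t..t} v \<partial>lborel)"
    by (rule nn_integral_add) auto
  also have "(\<integral>\<^sup>+v. ennreal (std_normal_density v) \<partial>lborel) = 1"
    by (subst nn_integral_eq_integral) auto
  also have "(\<integral>\<^sup>+v. indicator {-t..t} v \<partial>lborel) = ennreal (2 * t)" using t by simp
  also have "1 + ennreal (2 * t) = ennreal (1 + 2 * t)" using t by (simp add: ennreal_plus)
  also have "\<dots> \<le> ennreal (exp (2 * t))" by (intro ennreal_leI exp_ge_add_one_self)
  finally show ?thesis .
qed

section \<open>Mean and exponential moment of the signed products\<close>

lemma ip_linear: "ip n (\<lambda>i. a * x i + b * y i) v = a * ip n x v + b * ip n y v"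
  by (simp add: ip_def sum_distrib_left sum.distrib algebra_simps)

lemma ip_commute: "ip n x y = ip n y x"
  by (simp add: ip_def mult.commute)

text \<open>The degenerate case is included, although the product then has no density, because the
  lemma is applied to combinations \<open>x + t y\<close> that may vanish.\<close>

lemma integrable_abs_ip_gvec:
  assumes j: "j < m"
  shows "integrable (gauss_space m n) (\<lambda>w. \<bar>ip n z (gvec w j)\<bar>)"
    and "(\<integral>w. \<bar>ip n z (gvec w j)\<bar> \<partial>gauss_space m n) = sqrt (2 / pi) * nrm n z"
proof -
  have "integrable (gauss_space m n) (\<lambda>w. \<bar>ip n z (gvec w j)\<bar>) \<and>
    (\<integral>w. \<bar>ip n z (gvec w j)\<bar> \<partial>gauss_space m n) = sqrt (2 / pi) * nrm n z"
  proof (cases "nrm n z = 0")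
    case True
    then have "z i = 0" if "i \<le> n" for i using that by (simp add: L2_set_eq_0_iff)
    then have "ip n z v = 0" for v by (simp add: ip_def)
    then show ?thesis using True by simp
  next
    case False
    then have s: "0 < nrm n z" using L2_set_nonneg[of z "{..n}"] by linarith
    have D: "distributed (gauss_space m n) lborel (\<lambda>w. ip n z (gvec w j)) (normal_density 0 (nrm n z))"
      by (rule distributed_ip_gvec[OF j _ s]) (simp add: nrm_ip)
    have H: "has_bochner_integral lborel (\<lambda>v. normal_density 0 (nrm n z) v * \<bar>v\<bar>) (sqrt (2 / pi) * nrm n z)"
      using normal_moment_abs_odd[OF s, of 0 0] by (simp add: mult.commute)
    have "integrable (gauss_space m n) (\<lambda>w. \<bar>ip n z (gvec w j)\<bar>)"
      using distributed_integrable[OF D, of abs] H by (simp add: has_bochner_integral_iff)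
    moreover have "(\<integral>w. \<bar>ip n z (gvec w j)\<bar> \<partial>gauss_space m n) = sqrt (2 / pi) * nrm n z"
      using distributed_integral[OF D, of abs] H by (simp add: has_bochner_integral_iff)
    ultimately show ?thesis by simp
  qed
  then show "integrable (gauss_space m n) (\<lambda>w. \<bar>ip n z (gvec w j)\<bar>)"
    and "(\<integral>w. \<bar>ip n z (gvec w j)\<bar> \<partial>gauss_space m n) = sqrt (2 / pi) * nrm n z" by auto
qed

lemma integrable_sgn_ip_gvec:
  assumes j: "j < m"
  shows "integrable (gauss_space m n) (\<lambda>w. sgn (ip n x (gvec w j)) * ip n y (gvec w j))"
proof (rule Bochner_Integration.integrable_bound[OF integrable_abs_ip_gvec(1)[OF j, of n y]])
  show "(\<lambda>w. sgn (ip n x (gvec w j)) * ip n y (gvec w j)) \<in> borel_measurable (gauss_space m n)"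
    using measurable_ip_gvec[OF j] by (intro borel_measurable_times borel_measurable_sgn) auto
qed (auto simp: abs_mult abs_sgn_eq)

text \<open>The subgradient inequality \<open>E|<x + t y, g>| \<ge> E|<x, g>| + t E(sgn <x, g> <y, g>)\<close> for all real \<open>t\<close>
  pins down the last expectation as a derivative; no joint law of the two gaussians is needed.\<close>
lemma expectation_sgn_ip_gvec:
  assumes j: "j < m" and x: "ip n x x = 1"
  shows "(\<integral>w. sgn (ip n x (gvec w j)) * ip n y (gvec w j) \<partial>gauss_space m n) = sqrt (2 / pi) * ip n x y"
proof -
  define c where "c = sqrt (2 / pi)"
  define f where "f = (\<integral>w. sgn (ip n x (gvec w j)) * ip n y (gvec w j) \<partial>gauss_space m n)"
  define b where "b = ip n x y"
  define e where "e = c * ip n y y / 2"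
  define d where "d = c * b - f"
  have c0: "0 < c" by (simp add: c_def)
  have e0: "0 \<le> e" using c0 by (simp add: e_def ip_def sum_nonneg)
  have nx: "nrm n x = 1" using x nrm_ip[of x n] L2_set_nonneg[of x "{..n}"] by (simp add: power2_eq_1_iff)
  have key: "0 \<le> t * d + e * t\<^sup>2" for t
  proof -
    let ?z = "\<lambda>i. 1 * x i + t * y i"
    have zz: "ip n ?z ?z = 1 + (2 * t * b + t\<^sup>2 * ip n y y)"
      by (simp only: ip_linear ip_commute[of n x ?z] ip_commute[of n y ?z])
        (simp add: x b_def ip_commute[of n y x] power2_eq_square algebra_simps)
    define p where "p = 2 * t * b + t\<^sup>2 * ip n y y"
    \<comment> \<open>The tangent bound sqrt (1 + p) \<le> 1 + p/2 makes the estimate quadratic in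
      \<open>t\<close>.\<close>
    have nz: "nrm n ?z \<le> 1 + p / 2"
    proof (rule power2_le_imp_le)
      show "(nrm n ?z)\<^sup>2 \<le> (1 + p / 2)\<^sup>2"
        unfolding nrm_ip zz p_def[symmetric] by (simp add: power2_eq_square field_simps)
      have "0 \<le> 1 + p" using zz nrm_ip[of ?z n] zero_le_power2[of "nrm n ?z"] unfolding p_def by linarith
      then show "0 \<le> 1 + p / 2" by linarith
    qed
    have "c + t * f = (\<integral>w. \<bar>ip n x (gvec w j)\<bar> + t * (sgn (ip n x (gvec w j)) * ip n y (gvec w j)) \<partial>gauss_space m n)"
      using integrable_abs_ip_gvec[OF j, of n x] integrable_sgn_ip_gvec[OF j, of n x y] nx
      by (simp add: f_def c_def)
    also have "\<dots> \<le> (\<integral>w. \<bar>ip n ?z (gvec w j)\<bar> \<partial>gauss_space m n)"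
    proof (intro integral_mono)
      show "integrable (gauss_space m n) (\<lambda>w. \<bar>ip n x (gvec w j)\<bar> + t * (sgn (ip n x (gvec w j)) * ip n y (gvec w j)))"
        using integrable_abs_ip_gvec(1)[OF j, of n x] integrable_sgn_ip_gvec[OF j, of n x y] by simp
      show "integrable (gauss_space m n) (\<lambda>w. \<bar>ip n ?z (gvec w j)\<bar>)" by (rule integrable_abs_ip_gvec(1)[OF j])
      show "\<bar>ip n x (gvec w j)\<bar> + t * (sgn (ip n x (gvec w j)) * ip n y (gvec w j)) \<le> \<bar>ip n ?z (gvec w j)\<bar>" for w
        unfolding ip_linear by (auto simp: sgn_if abs_if)
    qed
    also have "\<dots> = c * nrm n ?z" using integrable_abs_ip_gvec(2)[OF j, of n ?z] by (simp add: c_def)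
    also have "\<dots> \<le> c * (1 + p / 2)" using nz c0 by (intro mult_left_mono) auto
    finally show ?thesis by (simp add: d_def e_def p_def field_simps)
  qed
  have "d = 0"
  proof (rule ccontr)
    assume "d \<noteq> 0"
    \<comment> \<open>A value at which the quadratic is negative unless \<open>d = 0\<close>; the
      denominator \<open>e + 1\<close> stays positive even if \<open>e = 0\<close>.\<close>
    define t where "t = - d / (e + 1)"
    have "t * d + e * t\<^sup>2 = - (d\<^sup>2 / (e + 1)\<^sup>2)"
      using e0 by (simp add: t_def power2_eq_square divide_simps) (simp add: algebra_simps)
    also have "\<dots> < 0" using \<open>d \<noteq> 0\<close> e0 by (simp add: add_nonneg_eq_0_iff)
    finally show False using key[of t] by simp
  qed
  then show ?thesis by (simp add: d_def f_def b_def c_def)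
qed

lemma ip_le_nrm: "\<bar>ip n x y\<bar> \<le> nrm n x * nrm n y"
proof -
  have "\<bar>ip n x y\<bar> \<le> (\<Sum>i\<le>n. \<bar>x i * y i\<bar>)" unfolding ip_def by (rule sum_abs)
  also have "\<dots> = (\<Sum>i\<le>n. \<bar>x i\<bar> * \<bar>y i\<bar>)" by (simp add: abs_mult)
  also have "\<dots> \<le> nrm n x * nrm n y" by (rule L2_set_mult_ineq)
  finally show ?thesis .
qed

lemma sqrt_2_pi_le_1: "sqrt (2 / pi) \<le> 1"
  using pi_gt3 by simp

text \<open>The centred variable \<open>W\<close> satisfies W^2 \<le> 2 <y, g>^2 + 2, so
  \<open>exp_le_self_plus_exp_square\<close> reduces the claim to
  \<open>nn_integral_exp_square\<close> with parameter 2 \<theta>^2, which must be at most 1/4. The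
  constant 6 is 2 from the additive term plus 4 from that moment.\<close>

lemma nn_integral_exp_sgn:
  assumes j: "j < m" and x: "ip n x x = 1" and y: "ip n y y = 1" and \<theta>: "\<theta>\<^sup>2 \<le> 1 / 8"
  shows "(\<integral>\<^sup>+w. ennreal (exp (\<theta> * (sgn (ip n x (gvec w j)) * ip n y (gvec w j) - sqrt (2 / pi) * ip n x y)))
      \<partial>gauss_space m n) \<le> ennreal (exp (6 * \<theta>\<^sup>2))"
proof -
  interpret prob_space "gauss_space m n" by (rule prob_space_gauss_space)
  let ?M = "gauss_space m n"
  define \<mu> where "\<mu> = sqrt (2 / pi) * ip n x y"
  define W where "W w = sgn (ip n x (gvec w j)) * ip n y (gvec w j) - \<mu>" for w
  define H where "H w = exp (2 * \<theta>\<^sup>2 * (ip n y (gvec w j))\<^sup>2)" for w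
  have nrm1: "nrm n x = 1" "nrm n y = 1"
    using x y nrm_ip[of x n] nrm_ip[of y n] L2_set_nonneg[of x "{..n}"] L2_set_nonneg[of y "{..n}"]
    by (simp_all add: power2_eq_1_iff)
  have "\<bar>\<mu>\<bar> \<le> 1 * (nrm n x * nrm n y)"
    unfolding \<mu>_def abs_mult using sqrt_2_pi_le_1 by (intro mult_mono ip_le_nrm) auto
  then have \<mu>: "\<mu>\<^sup>2 \<le> 1" using nrm1 by (simp add: abs_square_le_1)
  have intW: "integrable ?M W" unfolding W_def using integrable_sgn_ip_gvec[OF j] by simp
  have EW: "(\<integral>w. W w \<partial>?M) = 0"
    unfolding W_def using integrable_sgn_ip_gvec[OF j, of n x y] expectation_sgn_ip_gvec[OF j x, of y]
    by (simp add: prob_space \<mu>_def)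
  have H0: "0 \<le> H w" for w by (simp add: H_def)
  have measH: "H \<in> borel_measurable ?M"
    unfolding H_def using measurable_ip_gvec[OF j, of n y] by simp
  have nnH: "(\<integral>\<^sup>+w. ennreal (H w) \<partial>?M) \<le> ennreal (exp (4 * \<theta>\<^sup>2))"
    using nn_integral_exp_square[OF j y, of "2 * \<theta>\<^sup>2"] \<theta> by (simp add: H_def)
  have intH: "integrable ?M H"
  proof (rule integrableI_bounded[OF measH])
    show "(\<integral>\<^sup>+w. ennreal (norm (H w)) \<partial>?M) < \<infinity>"
      using nnH by (simp add: H_def le_less_trans[OF _ ennreal_less_top])
  qed
  have "ennreal (\<integral>w. H w \<partial>?M) \<le> ennreal (exp (4 * \<theta>\<^sup>2))"
    using nnH nn_integral_eq_integral[OF intH] H0 by simp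
  then have EH: "(\<integral>w. H w \<partial>?M) \<le> exp (4 * \<theta>\<^sup>2)" by (simp add: ennreal_le_iff)
  have pt: "exp (\<theta> * W w) \<le> \<theta> * W w + exp (2 * \<theta>\<^sup>2) * H w" for w
  proof -
    let ?v = "ip n y (gvec w j)"
    have "(sgn (ip n x (gvec w j)) * ?v)\<^sup>2 \<le> ?v\<^sup>2" by (auto simp: sgn_if)
    moreover have "(a - b)\<^sup>2 \<le> 2 * a\<^sup>2 + 2 * b\<^sup>2" for a b :: real
      using zero_le_power2[of "a + b"] by (simp add: power2_eq_square algebra_simps)
    ultimately have "(W w)\<^sup>2 \<le> 2 * ?v\<^sup>2 + 2 * 1" using \<mu> unfolding W_def
      by (smt (verit, best))
    then have "\<theta>\<^sup>2 * (W w)\<^sup>2 \<le> \<theta>\<^sup>2 * (2 * ?v\<^sup>2 + 2 * 1)" by (intro mult_left_mono) auto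
    then have "exp ((\<theta> * W w)\<^sup>2) \<le> exp (2 * \<theta>\<^sup>2) * H w"
      by (simp add: H_def exp_add[symmetric] power_mult_distrib algebra_simps)
    then show ?thesis using exp_le_self_plus_exp_square[of "\<theta> * W w"] by linarith
  qed
  have pos: "0 \<le> \<theta> * W w + exp (2 * \<theta>\<^sup>2) * H w" for w
    using pt[of w] exp_gt_zero[of "\<theta> * W w"] by linarith
  have "(\<integral>\<^sup>+w. ennreal (exp (\<theta> * W w)) \<partial>?M) \<le> (\<integral>\<^sup>+w. ennreal (\<theta> * W w + exp (2 * \<theta>\<^sup>2) * H w) \<partial>?M)"
    by (intro nn_integral_mono ennreal_leI pt)
  also have "\<dots> = ennreal (\<integral>w. \<theta> * W w + exp (2 * \<theta>\<^sup>2) * H w \<partial>?M)"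
    using intW intH pos by (intro nn_integral_eq_integral) auto
  also have "(\<integral>w. \<theta> * W w + exp (2 * \<theta>\<^sup>2) * H w \<partial>?M) = exp (2 * \<theta>\<^sup>2) * (\<integral>w. H w \<partial>?M)"
    using intW intH EW by simp
  also have "ennreal \<dots> \<le> ennreal (exp (2 * \<theta>\<^sup>2) * exp (4 * \<theta>\<^sup>2))"
    using EH by (intro ennreal_leI mult_left_mono) auto
  also have "exp (2 * \<theta>\<^sup>2) * exp (4 * \<theta>\<^sup>2) = exp (6 * \<theta>\<^sup>2)" by (simp add: exp_add[symmetric])
  finally show ?thesis by (simp add: W_def \<mu>_def)
qed

subsection \<open>Concentration at fixed points\<close>

text \<open>The parameters \<delta>/48 and -\<delta>/48, one for each tail, minimize the exponent 6
  \<theta>^2 - |\<theta>| \<delta>/4; the minimum is -\<delta>^2/384.\<close>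

lemma tail_deviation:
  assumes x: "ip n x x = 1" and y: "ip n y y = 1" and \<delta>: "0 < \<delta>" "\<delta> \<le> 1" and m: "0 < m"
  shows "measure (gauss_space m n) {w \<in> space (gauss_space m n).
      \<delta> / 4 \<le> \<bar>avg m (\<lambda>j. sgn (ip n x (gvec w j)) * ip n y (gvec w j)) - sqrt (2 / pi) * ip n x y\<bar>}
    \<le> 2 * exp (- (real m * \<delta>\<^sup>2 / 384))" (is "measure ?M ?B \<le> _")
proof -
  interpret prob_space ?M by (rule prob_space_gauss_space)
  define \<mu> where "\<mu> = sqrt (2 / pi) * ip n x y"
  define f where "f \<theta> u v = \<theta> * (sgn u * v - \<mu>)" for \<theta> u v :: real
  define T where "T \<theta> w = (\<Sum>j<m. f \<theta> (ip n x (gvec w j)) (ip n y (gvec w j)))" for \<theta> w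
  define A where "A \<theta> = {w \<in> space ?M. real m * (\<delta>\<^sup>2 / 192) \<le> T \<theta> w}" for \<theta>
  have fm: "(\<lambda>(u, v). f \<theta> u v) \<in> borel_measurable (borel \<Otimes>\<^sub>M borel)" for \<theta>
    unfolding f_def by measurable
  have one: "measure ?M (A \<theta>) \<le> exp (- (real m * \<delta>\<^sup>2 / 384))" if \<theta>: "\<theta>\<^sup>2 = (\<delta> / 48)\<^sup>2" for \<theta>
  proof -
    have "\<delta>\<^sup>2 \<le> 1" using \<delta> by (simp add: power_le_one)
    then have \<theta>8: "\<theta>\<^sup>2 \<le> 1 / 8" unfolding \<theta> by (simp add: power_divide)
    have "measure ?M (A \<theta>) \<le> exp (real m * (6 * \<theta>\<^sup>2 - \<delta>\<^sup>2 / 192))"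
      unfolding A_def T_def
    proof (rule chernoff_rows[OF fm])
      fix j assume "j < m"
      from nn_integral_exp_sgn[OF this x y \<theta>8]
      show "(\<integral>\<^sup>+w. ennreal (exp (f \<theta> (ip n x (gvec w j)) (ip n y (gvec w j)))) \<partial>?M) \<le> ennreal (exp (6 * \<theta>\<^sup>2))"
        by (simp add: f_def \<mu>_def)
    qed
    also have "real m * (6 * \<theta>\<^sup>2 - \<delta>\<^sup>2 / 192) = - (real m * \<delta>\<^sup>2 / 384)"
      unfolding \<theta> by (simp add: power_divide)
    finally show ?thesis .
  qed
  have Am: "A \<theta> \<in> sets ?M" for \<theta>
  proof -
    have "(\<lambda>w. T \<theta> w) \<in> borel_measurable ?M"
      unfolding T_def f_def using measurable_ip_gvec
      by (intro borel_measurable_sum borel_measurable_times borel_measurable_const borel_measurable_diff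
          borel_measurable_sgn) auto
    then show ?thesis unfolding A_def by (intro borel_measurable_le) auto
  qed
  have "?B \<subseteq> A (\<delta> / 48) \<union> A (- (\<delta> / 48))"
  proof
    fix w assume w: "w \<in> ?B"
    define a where "a = avg m (\<lambda>j. sgn (ip n x (gvec w j)) * ip n y (gvec w j)) - \<mu>"
    have T: "T \<theta> w = \<theta> * (real m * a)" for \<theta>
      using m by (simp add: T_def f_def a_def sum_distrib_left[symmetric] sum_subtractf right_diff_distrib)
    have "\<delta> / 4 \<le> \<bar>a\<bar>" using w by (simp add: a_def \<mu>_def)
    then have "\<delta> / 4 \<le> a \<or> \<delta> / 4 \<le> - a" by linarith
    then have "\<delta> / 48 * real m * (\<delta> / 4) \<le> \<delta> / 48 * real m * a \<or>
        \<delta> / 48 * real m * (\<delta> / 4) \<le> \<delta> / 48 * real m * (- a)"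
      using \<delta> by (meson mult_left_mono divide_nonneg_nonneg less_imp_le mult_nonneg_nonneg of_nat_0_le_iff zero_le_numeral)
    moreover have "\<delta> / 48 * real m * (\<delta> / 4) = real m * (\<delta>\<^sup>2 / 192)" by (simp add: power2_eq_square)
    ultimately have "real m * (\<delta>\<^sup>2 / 192) \<le> T (\<delta> / 48) w \<or> real m * (\<delta>\<^sup>2 / 192) \<le> T (- (\<delta> / 48)) w"
      unfolding T by (simp only: mult.assoc mult_minus_left mult_minus_right)
    then show "w \<in> A (\<delta> / 48) \<union> A (- (\<delta> / 48))" using w by (auto simp only: A_def)
  qed
  then have "measure ?M ?B \<le> measure ?M (A (\<delta> / 48) \<union> A (- (\<delta> / 48)))"
    using Am by (intro finite_measure_mono) auto
  also have "\<dots> \<le> measure ?M (A (\<delta> / 48)) + measure ?M (A (- (\<delta> / 48)))"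
    using Am by (intro measure_Un_le) auto
  also have "\<dots> \<le> 2 * exp (- (real m * \<delta>\<^sup>2 / 384))"
    using one[of "\<delta> / 48"] one[of "- (\<delta> / 48)"] by simp
  finally show ?thesis .
qed

text \<open>The largest parameter allowed by \<open>nn_integral_exp_square\<close>, 1/4, turns the
  threshold 4 into 1 against an exponential moment of \<open>exp (1 / 2)\<close>.\<close>

lemma tail_squares:
  assumes y: "ip n y y = 1"
  shows "measure (gauss_space m n) {w \<in> space (gauss_space m n).
      real m * 4 \<le> (\<Sum>j<m. (ip n y (gvec w j))\<^sup>2)} \<le> exp (- (real m / 2))" (is "measure ?M ?B \<le> _")
proof -
  have eq: "?B = {w \<in> space ?M. real m * 1 \<le> (\<Sum>j<m. 1 / 4 * (ip n y (gvec w j))\<^sup>2)}"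
    by (auto simp: sum_distrib_left[symmetric] simp del: times_divide_eq_left)
  have "measure ?M ?B \<le> exp (real m * (1 / 2 - 1))"
    unfolding eq
  proof (rule chernoff_rows[where f = "\<lambda>u v. 1 / 4 * v\<^sup>2" and x = y])
    show "(\<lambda>(u :: real, v :: real). 1 / 4 * v\<^sup>2) \<in> borel_measurable (borel \<Otimes>\<^sub>M borel)" by measurable
    fix j assume "j < m"
    from nn_integral_exp_square[OF this y, of "1 / 4"]
    show "(\<integral>\<^sup>+w. ennreal (exp (1 / 4 * (ip n y (gvec w j))\<^sup>2)) \<partial>?M) \<le> ennreal (exp (1 / 2))" by simp
  qed
  then show ?thesis by simp
qed

text \<open>Chernoff with parameter 1 gives a rate linear in \<open>k - 2 * t\<close>. A quadratic
  rate would be of order \<delta>^4 for \<open>k\<close> and \<open>t\<close> of order \<delta>^2,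
  too slow for the sample size.\<close>

lemma tail_small_count:
  assumes x: "ip n x x = 1" and t: "0 \<le> t"
  shows "measure (gauss_space m n) {w \<in> space (gauss_space m n).
      real m * k \<le> (\<Sum>j<m. indicator {-t..t} (ip n x (gvec w j)))} \<le> exp (real m * (2 * t - k))"
proof (rule chernoff_rows[where f = "\<lambda>u v. indicator {-t..t} u" and y = x])
  show "(\<lambda>(u :: real, v :: real). indicator {-t..t} u :: real) \<in> borel_measurable (borel \<Otimes>\<^sub>M borel)" by measurable
  fix j assume "j < m"
  then show "(\<integral>\<^sup>+w. ennreal (exp (indicator {-t..t} (ip n x (gvec w j)))) \<partial>gauss_space m n) \<le> ennreal (exp (2 * t))"
    using x t by (rule nn_integral_exp_indicator)
qed

subsection \<open>From the net to the sparse sphere\<close>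

text \<open>If \<open>b\<close> lies outside the band and the signs differ, then \<open>a\<close>
  and \<open>b\<close> are at least \<open>t\<close> apart, and 4 is the largest squared difference
  of signs. The quadratic form of the second term lets it be summed by the operator norm.\<close>

lemma sgn_diff_square_le:
  fixes a b t :: real
  assumes t: "0 < t"
  shows "(sgn a - sgn b)\<^sup>2 \<le> 4 * indicator {-t..t} b + 4 * (a - b)\<^sup>2 / t\<^sup>2"
proof (cases "\<bar>b\<bar> \<le> t \<or> sgn a = sgn b")
  case True
  have "(sgn a - sgn b)\<^sup>2 \<le> 4 * indicator {-t..t} b"
  proof (cases "sgn a = sgn b")
    case False
    then have "(indicator {-t..t} b :: real) = 1" using True by (simp add: abs_le_iff)
    then show ?thesis by (auto simp: sgn_if)
  qed simp
  moreover have "0 \<le> 4 * (a - b)\<^sup>2 / t\<^sup>2" by simp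
  ultimately show ?thesis by linarith
next
  case False
  then have "t \<le> \<bar>a - b\<bar>" by (auto simp: sgn_if abs_if split: if_splits)
  then have "t\<^sup>2 \<le> (a - b)\<^sup>2" using t by (metis abs_le_square_iff abs_of_pos)
  then have "1 \<le> (a - b)\<^sup>2 / t\<^sup>2" using t by simp
  moreover have "(sgn a - sgn b)\<^sup>2 \<le> 4" by (auto simp: sgn_if)
  moreover have "0 \<le> (4 * indicator {-t..t} b :: real)" by simp
  ultimately show ?thesis by linarith
qed

lemma ip_diff_left: "ip n (\<lambda>i. x i - y i) v = ip n x v - ip n y v"
  by (simp add: ip_def left_diff_distrib sum_subtractf)

lemma ip_scale_left: "ip n (\<lambda>i. c * x i) v = c * ip n x v"
  by (simp add: ip_def sum_distrib_left mult.assoc)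

lemma L2_set_ip_le_scaled:
  assumes z: "\<forall>i>n. z i = 0" "card {i\<in>{..n}. z i \<noteq> 0} \<le> s"
    and M: "\<And>x. x \<in> sparse_sphere n s \<Longrightarrow> L2_set (\<lambda>j. ip n x (g j)) {..<m} \<le> M"
  shows "L2_set (\<lambda>j. ip n z (g j)) {..<m} \<le> M * nrm n z"
proof (cases "nrm n z = 0")
  case True
  then have "z i = 0" if "i \<le> n" for i using that by (simp add: L2_set_eq_0_iff)
  then have "ip n z v = 0" for v by (simp add: ip_def)
  then show ?thesis using True by (simp add: L2_set_def)
next
  case False
  then have r: "0 < nrm n z" using L2_set_nonneg[of z "{..n}"] by linarith
  define x where "x i = 1 / nrm n z * z i" for i
  have "ip n x x = (1 / nrm n z)\<^sup>2 * ip n z z"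
    by (simp add: ip_def x_def sum_divide_distrib power2_eq_square)
  then have "ip n x x = 1" using r by (simp add: nrm_ip[symmetric] power_divide)
  moreover have "{i\<in>{..n}. x i \<noteq> 0} = {i\<in>{..n}. z i \<noteq> 0}" using r by (auto simp: x_def)
  ultimately have "x \<in> sparse_sphere n s" using z by (simp add: sparse_sphere_iff x_def)
  then have "L2_set (\<lambda>j. 1 / nrm n z * ip n z (g j)) {..<m} \<le> M"
    using M[of x] unfolding x_def ip_scale_left by simp
  then have "1 / nrm n z * L2_set (\<lambda>j. ip n z (g j)) {..<m} \<le> M"
    using r by (subst L2_set_right_distrib) auto
  then show ?thesis using r by (simp add: pos_divide_le_eq)
qed

text \<open>The support condition in \<open>net\<close> is essential for the form of the argument:
  it keeps \<open>x - u\<close> supported where \<open>x\<close> is, hence \<open>s\<close>-sparse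
  rather than 2 s-sparse, so bounds on \<open>sparse_sphere n s\<close> apply to the differences
  after scaling.\<close>

locale sparse_net =
  fixes n s :: nat and \<rho> :: real and N :: "(nat \<Rightarrow> real) set"
  assumes net_sub: "N \<subseteq> sparse_sphere n s"
    and net: "x \<in> sparse_sphere n s \<Longrightarrow>
      \<exists>u\<in>N. (\<forall>i. x i = 0 \<longrightarrow> u i = 0) \<and> nrm n (\<lambda>i. x i - u i) \<le> \<rho>"
begin

lemma obtain_net:
  assumes "x \<in> sparse_sphere n s"
  obtains u where "u \<in> N" "u \<in> sparse_sphere n s" "nrm n (\<lambda>i. x i - u i) \<le> \<rho>"
    "\<forall>i>n. x i - u i = 0" "card {i\<in>{..n}. x i - u i \<noteq> 0} \<le> s"
proof -
  obtain u where u: "u \<in> N" "\<And>i. x i = 0 \<Longrightarrow> u i = 0" "nrm n (\<lambda>i. x i - u i) \<le> \<rho>"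
    using net[OF assms] by blast
  have "card {i\<in>{..n}. x i - u i \<noteq> 0} \<le> card {i\<in>{..n}. x i \<noteq> 0}"
    using u(2) by (intro card_mono) auto
  then show ?thesis
    using that[of u] u assms net_sub by (auto simp: sparse_sphere_iff)
qed

text \<open>At a maximizer \<open>z\<close>, which exists by compactness, the difference to its net
  point contributes at most half of the maximum itself and the net point at most
  \<open>2 * sqrt m\<close>; solving for the maximum doubles the latter.\<close>

lemma operator_bound:
  assumes \<rho>: "\<rho> \<le> 1 / 2" and x: "x \<in> sparse_sphere n s"
    and N: "\<And>u. u \<in> N \<Longrightarrow> (\<Sum>j<m. (ip n u (g j))\<^sup>2) \<le> real m * 4"
  shows "L2_set (\<lambda>j. ip n x (g j)) {..<m} \<le> 4 * sqrt (real m)"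
proof -
  let ?A = "\<lambda>x. L2_set (\<lambda>j. ip n x (g j)) {..<m}"
  have cont: "continuous_on (sparse_sphere n s) ?A"
    unfolding L2_set_def
    by (intro continuous_on_real_sqrt continuous_on_sum continuous_on_power continuous_on_ip
        continuous_on_id continuous_on_const)
  have "sparse_sphere n s \<noteq> {}" using x by blast
  from continuous_attains_sup[OF compact_sparse_sphere this cont]
  obtain z where z: "z \<in> sparse_sphere n s" "\<And>y. y \<in> sparse_sphere n s \<Longrightarrow> ?A y \<le> ?A z"
    by blast
  obtain u where u: "u \<in> N" "u \<in> sparse_sphere n s" "nrm n (\<lambda>i. z i - u i) \<le> \<rho>"
    and d: "\<forall>i>n. z i - u i = 0" "card {i\<in>{..n}. z i - u i \<noteq> 0} \<le> s"
    by (rule obtain_net[OF z(1)])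
  have "?A z \<le> ?A (\<lambda>i. z i - u i) + ?A u"
    unfolding ip_diff_left using L2_set_triangle_ineq[of "\<lambda>j. ip n z (g j) - ip n u (g j)" "\<lambda>j. ip n u (g j)" "{..<m}"] by simp
  also have "?A u \<le> sqrt (real m * 4)" unfolding L2_set_def using N[OF u(1)] by simp
  also have "\<dots> = 2 * sqrt (real m)" by (simp add: real_sqrt_mult)
  also have "?A (\<lambda>i. z i - u i) \<le> ?A z * nrm n (\<lambda>i. z i - u i)"
    using d z(2) by (intro L2_set_ip_le_scaled) auto
  also have "\<dots> \<le> ?A z * (1 / 2)"
    using u(3) \<rho> by (intro mult_left_mono) auto
  finally have "?A z \<le> 4 * sqrt (real m)" by simp
  then show ?thesis using z(2)[OF x] by linarith
qed

text \<open>A deterministic statement about vectors \<open>g\<close>. The budget is \<delta>/2 for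
  changed signs (\<delta>/8 for their root mean square times the operator bound 4), 4 \<rho> for
  replacing \<open>y\<close> by \<open>v\<close>, 2 \<rho> for the inner products, and \<delta>/4 on
  the net; hence the condition on 6 \<rho>.\<close>

lemma uniform_deviation:
  fixes \<delta> t \<kappa> c :: real
  assumes m: "0 < m" and t: "0 < t" and \<rho>: "\<rho> \<le> 1 / 2" "6 * \<rho> \<le> \<delta> / 4" and \<delta>: "0 < \<delta>"
    and c: "0 \<le> c" "c \<le> 1"
    and small: "4 * \<kappa> + 64 * \<rho>\<^sup>2 / t\<^sup>2 \<le> \<delta>\<^sup>2 / 64"
    and G1: "\<And>u v. u \<in> N \<Longrightarrow> v \<in> N \<Longrightarrow>
        \<bar>avg m (\<lambda>j. sgn (ip n u (g j)) * ip n v (g j)) - c * ip n u v\<bar> \<le> \<delta> / 4"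
    and G2: "\<And>u. u \<in> N \<Longrightarrow> (\<Sum>j<m. (ip n u (g j))\<^sup>2) \<le> real m * 4"
    and G3: "\<And>u. u \<in> N \<Longrightarrow> (\<Sum>j<m. indicator {-t..t} (ip n u (g j))) \<le> real m * \<kappa>"
    and x: "x \<in> sparse_sphere n s" and y: "y \<in> sparse_sphere n s"
  shows "\<bar>avg m (\<lambda>j. sgn (ip n x (g j)) * ip n y (g j)) - c * ip n x y\<bar> \<le> \<delta>"
proof -
  let ?A = "\<lambda>x. L2_set (\<lambda>j. ip n x (g j)) {..<m}"
  note op = operator_bound[OF \<rho>(1) _ G2]
  obtain u where u: "u \<in> N" "u \<in> sparse_sphere n s" "nrm n (\<lambda>i. x i - u i) \<le> \<rho>"
    and du: "\<forall>i>n. x i - u i = 0" "card {i\<in>{..n}. x i - u i \<noteq> 0} \<le> s"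
    by (rule obtain_net[OF x])
  obtain v where v: "v \<in> N" "v \<in> sparse_sphere n s" "nrm n (\<lambda>i. y i - v i) \<le> \<rho>"
    and dv: "\<forall>i>n. y i - v i = 0" "card {i\<in>{..n}. y i - v i \<noteq> 0} \<le> s"
    by (rule obtain_net[OF y])
  have \<rho>0: "0 \<le> \<rho>" using u(3) L2_set_nonneg[of "\<lambda>i. x i - u i" "{..n}"] by linarith
  have near: "?A (\<lambda>i. a i - b i) \<le> 4 * sqrt (real m) * \<rho>"
    if "\<forall>i>n. a i - b i = 0" "card {i\<in>{..n}. a i - b i \<noteq> 0} \<le> s" "nrm n (\<lambda>i. a i - b i) \<le> \<rho>" for a b
  proof -
    have "?A (\<lambda>i. a i - b i) \<le> 4 * sqrt (real m) * nrm n (\<lambda>i. a i - b i)"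
      using that op by (intro L2_set_ip_le_scaled) auto
    also have "\<dots> \<le> 4 * sqrt (real m) * \<rho>" using that(3) by (intro mult_left_mono) auto
    finally show ?thesis .
  qed
  define D where "D j = sgn (ip n x (g j)) - sgn (ip n u (g j))" for j
  have D2: "L2_set D {..<m} \<le> sqrt (real m) * (\<delta> / 8)"
  proof -
    have "(?A (\<lambda>i. x i - u i))\<^sup>2 \<le> (4 * sqrt (real m) * \<rho>)\<^sup>2"
      using near[OF du u(3)] by (intro power_mono) auto
    then have a: "(\<Sum>j<m. (ip n x (g j) - ip n u (g j))\<^sup>2) \<le> 16 * real m * \<rho>\<^sup>2"
      by (simp add: L2_set_def sum_nonneg ip_diff_left power_mult_distrib)
    have "(\<Sum>j<m. (D j)\<^sup>2) \<le> (\<Sum>j<m. 4 * indicator {-t..t} (ip n u (g j)) + 4 * (ip n x (g j) - ip n u (g j))\<^sup>2 / t\<^sup>2)"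
      unfolding D_def using t by (intro sum_mono sgn_diff_square_le)
    also have "\<dots> = 4 * (\<Sum>j<m. indicator {-t..t} (ip n u (g j))) + 4 * (\<Sum>j<m. (ip n x (g j) - ip n u (g j))\<^sup>2) / t\<^sup>2"
      by (simp add: sum.distrib sum_distrib_left sum_divide_distrib)
    also have "\<dots> \<le> 4 * (real m * \<kappa>) + 4 * (16 * real m * \<rho>\<^sup>2) / t\<^sup>2"
      using a G3[OF u(1)] by (intro add_mono mult_left_mono divide_right_mono) auto
    also have "\<dots> = real m * (4 * \<kappa> + 64 * \<rho>\<^sup>2 / t\<^sup>2)" by (simp add: algebra_simps)
    also have "\<dots> \<le> real m * (\<delta>\<^sup>2 / 64)" using small by (intro mult_left_mono) auto
    finally have "sqrt (\<Sum>j<m. (D j)\<^sup>2) \<le> sqrt (real m * (\<delta> / 8)\<^sup>2)"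
      by (simp add: power_divide)
    then show ?thesis using \<delta> by (simp add: L2_set_def real_sqrt_mult)
  qed
  have "\<bar>\<Sum>j<m. D j * ip n y (g j)\<bar> \<le> (\<Sum>j<m. \<bar>D j\<bar> * \<bar>ip n y (g j)\<bar>)"
    using sum_abs[of "\<lambda>j. D j * ip n y (g j)" "{..<m}"] by (simp add: abs_mult)
  also have "\<dots> \<le> L2_set D {..<m} * ?A y" by (rule L2_set_mult_ineq)
  also have "\<dots> \<le> (sqrt (real m) * (\<delta> / 8)) * (4 * sqrt (real m))"
    using D2 op[OF y] \<delta> by (intro mult_mono) auto
  also have "\<dots> = real m * (\<delta> / 2)" by simp
  finally have E1: "\<bar>\<Sum>j<m. D j * ip n y (g j)\<bar> \<le> real m * (\<delta> / 2)" .
  have "\<bar>\<Sum>j<m. sgn (ip n u (g j)) * ip n (\<lambda>i. y i - v i) (g j)\<bar> \<le>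
      (\<Sum>j<m. \<bar>sgn (ip n u (g j))\<bar> * \<bar>ip n (\<lambda>i. y i - v i) (g j)\<bar>)"
    using sum_abs[of "\<lambda>j. sgn (ip n u (g j)) * ip n (\<lambda>i. y i - v i) (g j)" "{..<m}"] by (simp add: abs_mult)
  also have "\<dots> \<le> (\<Sum>j<m. \<bar>1\<bar> * \<bar>ip n (\<lambda>i. y i - v i) (g j)\<bar>)"
    by (intro sum_mono mult_right_mono) (auto simp: sgn_if)
  also have "\<dots> \<le> L2_set (\<lambda>_. 1) {..<m} * ?A (\<lambda>i. y i - v i)" by (rule L2_set_mult_ineq)
  also have "\<dots> \<le> sqrt (real m) * (4 * sqrt (real m) * \<rho>)"
    using near[OF dv v(3)] by (intro mult_mono) (simp_all add: L2_set_constant)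
  also have "\<dots> = real m * (4 * \<rho>)" by simp
  finally have E2: "\<bar>\<Sum>j<m. sgn (ip n u (g j)) * ip n (\<lambda>i. y i - v i) (g j)\<bar> \<le> real m * (4 * \<rho>)" .
  have "\<bar>ip n x y - ip n u v\<bar> = \<bar>ip n (\<lambda>i. x i - u i) y + ip n (\<lambda>i. y i - v i) u\<bar>"
    by (simp add: ip_diff_left ip_commute[of n y u] ip_commute[of n v u])
  also have "\<dots> \<le> nrm n (\<lambda>i. x i - u i) * nrm n y + nrm n (\<lambda>i. y i - v i) * nrm n u"
    using ip_le_nrm[of n "\<lambda>i. x i - u i" y] ip_le_nrm[of n "\<lambda>i. y i - v i" u] by linarith
  also have "\<dots> \<le> 2 * \<rho>" using u(3) v(3) nrm_sparse_sphere[OF y] nrm_sparse_sphere[OF u(2)] by simp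
  finally have "c * \<bar>ip n x y - ip n u v\<bar> \<le> 1 * (2 * \<rho>)" using c by (intro mult_mono) auto
  then have E3: "\<bar>c * ip n x y - c * ip n u v\<bar> \<le> 2 * \<rho>"
    using c by (simp add: abs_mult right_diff_distrib[symmetric])
  have "(\<Sum>j<m. sgn (ip n x (g j)) * ip n y (g j)) - (\<Sum>j<m. sgn (ip n u (g j)) * ip n v (g j)) =
      (\<Sum>j<m. D j * ip n y (g j)) + (\<Sum>j<m. sgn (ip n u (g j)) * ip n (\<lambda>i. y i - v i) (g j))"
    unfolding sum.distrib[symmetric] sum_subtractf[symmetric] D_def ip_diff_left
    by (intro sum.cong) (auto simp: algebra_simps)
  then have "\<bar>(\<Sum>j<m. sgn (ip n x (g j)) * ip n y (g j)) - (\<Sum>j<m. sgn (ip n u (g j)) * ip n v (g j))\<bar>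
      \<le> real m * (\<delta> / 2 + 4 * \<rho>)"
    using E1 E2 by (simp add: distrib_left)
  then have "1 / real m * \<bar>(\<Sum>j<m. sgn (ip n x (g j)) * ip n y (g j)) - (\<Sum>j<m. sgn (ip n u (g j)) * ip n v (g j))\<bar>
      \<le> \<delta> / 2 + 4 * \<rho>"
    using m by (simp add: pos_divide_le_eq mult.commute)
  then have "\<bar>avg m (\<lambda>j. sgn (ip n x (g j)) * ip n y (g j)) - avg m (\<lambda>j. sgn (ip n u (g j)) * ip n v (g j))\<bar>
      \<le> \<delta> / 2 + 4 * \<rho>"
    using m by (simp add: diff_divide_distrib[symmetric])
  then show ?thesis using E3 G1[OF u(1) v(1)] \<rho>(2) by linarith
qed

end

section \<open>Union bound over the net and choice of constants\<close>

lemma (in sparse_net) failure_probability: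
  fixes \<delta> t \<kappa> :: real
  assumes m: "0 < m" and t: "0 < t" and \<rho>: "\<rho> \<le> 1 / 2" "6 * \<rho> \<le> \<delta> / 4" and \<delta>: "0 < \<delta>" "\<delta> \<le> 1"
    and small: "4 * \<kappa> + 64 * \<rho>\<^sup>2 / t\<^sup>2 \<le> \<delta>\<^sup>2 / 64" and N: "finite N"
  shows "measure (gauss_space m n) {w \<in> space (gauss_space m n).
      \<forall>x\<in>sparse_sphere n s. \<forall>y\<in>sparse_sphere n s.
        \<bar>avg m (\<lambda>j. sgn (ip n x (gvec w j)) * ip n y (gvec w j)) - sqrt (2 / pi) * ip n x y\<bar> \<le> \<delta>}
    \<ge> 1 - ((real (card N))\<^sup>2 * (2 * exp (- (real m * \<delta>\<^sup>2 / 384))) + real (card N) * exp (- (real m / 2))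
         + real (card N) * exp (real m * (2 * t - \<kappa>)))" (is "measure ?M ?G \<ge> _")
proof -
  interpret prob_space ?M by (rule prob_space_gauss_space)
  define B1 where "B1 = (\<lambda>(u, v). {w \<in> space ?M.
      \<delta> / 4 \<le> \<bar>avg m (\<lambda>j. sgn (ip n u (gvec w j)) * ip n v (gvec w j)) - sqrt (2 / pi) * ip n u v\<bar>})"
  define B2 where "B2 u = {w \<in> space ?M. real m * 4 \<le> (\<Sum>j<m. (ip n u (gvec w j))\<^sup>2)}" for u
  define B3 where "B3 u = {w \<in> space ?M. real m * \<kappa> \<le> (\<Sum>j<m. indicator {-t..t} (ip n u (gvec w j)))}" for u
  have ipN: "ip n u u = 1" if "u \<in> N" for u using that net_sub by (auto simp: sparse_sphere_iff)
  have B1m: "B1 p \<in> sets ?M" for p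
    unfolding B1_def using measurable_ip_gvec
    by (cases p) (auto intro!: borel_measurable_le borel_measurable_abs borel_measurable_diff borel_measurable_divide
        borel_measurable_sum borel_measurable_times borel_measurable_sgn borel_measurable_const)
  have B2m: "B2 u \<in> sets ?M" for u
    unfolding B2_def using measurable_ip_gvec
    by (intro borel_measurable_le borel_measurable_sum borel_measurable_power borel_measurable_const) auto
  have B3m: "B3 u \<in> sets ?M" for u
  proof -
    have "(\<lambda>w. indicator {-t..t} (ip n u (gvec w j)) :: real) \<in> borel_measurable ?M" if "j < m" for j
      using measurable_compose[OF measurable_ip_gvec[OF that, of n u], of "indicator {-t..t} :: real \<Rightarrow> real" borel] by simp
    then show ?thesis unfolding B3_def
      by (intro borel_measurable_le borel_measurable_sum borel_measurable_const) auto
  qed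
  have U1: "measure ?M (\<Union>p\<in>N \<times> N. B1 p) \<le> (real (card N))\<^sup>2 * (2 * exp (- (real m * \<delta>\<^sup>2 / 384)))"
  proof -
    have "measure ?M (\<Union>p\<in>N \<times> N. B1 p) \<le> (\<Sum>p\<in>N \<times> N. measure ?M (B1 p))"
      using N B1m by (intro measure_UNION_le) auto
    also have "\<dots> \<le> (\<Sum>p\<in>N \<times> N. 2 * exp (- (real m * \<delta>\<^sup>2 / 384)))"
      unfolding B1_def using ipN tail_deviation \<delta> m by (intro sum_mono) auto
    finally show ?thesis by (simp add: card_cartesian_product power2_eq_square)
  qed
  have U2: "measure ?M (\<Union>u\<in>N. B2 u) \<le> real (card N) * exp (- (real m / 2))"
  proof -
    have "measure ?M (\<Union>u\<in>N. B2 u) \<le> (\<Sum>u\<in>N. measure ?M (B2 u))"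
      using N B2m by (intro measure_UNION_le) auto
    also have "\<dots> \<le> (\<Sum>u\<in>N. exp (- (real m / 2)))"
      unfolding B2_def by (intro sum_mono tail_squares ipN)
    finally show ?thesis by simp
  qed
  have U3: "measure ?M (\<Union>u\<in>N. B3 u) \<le> real (card N) * exp (real m * (2 * t - \<kappa>))"
  proof -
    have "measure ?M (\<Union>u\<in>N. B3 u) \<le> (\<Sum>u\<in>N. measure ?M (B3 u))"
      using N B3m by (intro measure_UNION_le) auto
    also have "\<dots> \<le> (\<Sum>u\<in>N. exp (real m * (2 * t - \<kappa>)))"
      unfolding B3_def using t by (intro sum_mono tail_small_count ipN) auto
    finally show ?thesis by simp
  qed
  let ?B = "(\<Union>p\<in>N \<times> N. B1 p) \<union> (\<Union>u\<in>N. B2 u) \<union> (\<Union>u\<in>N. B3 u)"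
  have Bm: "(\<Union>p\<in>N \<times> N. B1 p) \<in> sets ?M" "(\<Union>u\<in>N. B2 u) \<in> sets ?M" "(\<Union>u\<in>N. B3 u) \<in> sets ?M"
    using N B1m B2m B3m by (auto intro!: sets.finite_UN)
  have "measure ?M ?B \<le> measure ?M (\<Union>p\<in>N \<times> N. B1 p) + measure ?M (\<Union>u\<in>N. B2 u) + measure ?M (\<Union>u\<in>N. B3 u)"
    using measure_Un_le[of "(\<Union>p\<in>N \<times> N. B1 p) \<union> (\<Union>u\<in>N. B2 u)" ?M "\<Union>u\<in>N. B3 u"]
      measure_Un_le[of "\<Union>p\<in>N \<times> N. B1 p" ?M "\<Union>u\<in>N. B2 u"] Bm by simp
  moreover have "space ?M - ?B \<subseteq> ?G"
  proof
    fix w assume w: "w \<in> space ?M - ?B"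
    have "\<bar>avg m (\<lambda>j. sgn (ip n x (gvec w j)) * ip n y (gvec w j)) - sqrt (2 / pi) * ip n x y\<bar> \<le> \<delta>"
      if "x \<in> sparse_sphere n s" "y \<in> sparse_sphere n s" for x y
    proof (rule uniform_deviation[OF m t \<rho> \<delta>(1) _ sqrt_2_pi_le_1 small _ _ _ that])
      fix u assume u: "u \<in> N"
      show "(\<Sum>j<m. (ip n u (gvec w j))\<^sup>2) \<le> real m * 4"
        using w u by (auto simp: B2_def not_le intro: less_imp_le)
      show "(\<Sum>j<m. indicator {-t..t} (ip n u (gvec w j))) \<le> real m * \<kappa>"
        using w u by (auto simp: B3_def not_le intro: less_imp_le)
      fix v assume v: "v \<in> N"
      have "w \<notin> B1 (u, v)" using w u v by blast
      then show "\<bar>avg m (\<lambda>j. sgn (ip n u (gvec w j)) * ip n v (gvec w j)) - sqrt (2 / pi) * ip n u v\<bar> \<le> \<delta> / 4"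
        using w unfolding B1_def by simp
    qed simp
    then show "w \<in> ?G" using w by blast
  qed
  \<comment> \<open>Monotonicity of \<open>measure\<close> asks for measurability of the larger set;
    this is where \<open>sets_uniform_deviation\<close> enters.\<close>
  then have "measure ?M (space ?M - ?B) \<le> measure ?M ?G"
    by (intro finite_measure_mono sets_uniform_deviation)
  moreover have "measure ?M (space ?M - ?B) = 1 - measure ?M ?B"
    using Bm by (intro prob_compl) auto
  ultimately show ?thesis using U1 U2 U3 by linarith
qed

text \<open>The hypothesis \<open>(s / (10 n))^4 < \<delta>\<close> makes \<open>log (1 / \<delta>)\<close> comparable to \<open>log (n / s)\<close>, so the
  size of a net of radius of order \<open>\<delta>^3\<close> is absorbed by the sample size.\<close>
lemma net_size_bound:
  fixes s n m :: nat and \<delta> K :: real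
  assumes s: "0 < s" "s \<le> n" and \<delta>: "0 < \<delta>" "\<delta> < 1" "(real s / (10 * real n)) ^ 4 < \<delta>"
    and K: "0 \<le> K" "K \<le> (exp 5 * real n / (real s * (\<delta> ^ 3 / 409600))) ^ s"
    and m: "200000 * \<delta> powr (-2) * real s * log_plus (real n / real s) \<le> real m"
  shows "4 * K\<^sup>2 * exp (- (real m * \<delta>\<^sup>2 / 1024)) \<le> (real s / (2 * real n)) ^ (2 * s)"
proof -
  define R where "R = real n / real s"
  define L where "L = log_plus R"
  have R: "1 \<le> R" using s by (simp add: R_def)
  have L: "1 \<le> L" "ln R \<le> L" by (auto simp: L_def log_plus_def)
  have "R = exp (ln R)" using R by simp
  also have "\<dots> \<le> exp L" using L(2) by simp
  finally have RL: "R \<le> exp L" .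
  have sL: "1 \<le> real s * L" using s L(1) mult_mono[of 1 "real s" 1 L] by simp
  have pow2: "2 ^ k \<le> exp (real k)" for k
    using power_mono[of "2::real" "exp 1" k] exp_ge_add_one_self[of 1] by (simp add: exp_of_nat_mult[symmetric])
  \<comment> \<open>The net radius involves \<delta>^3, so cubing the fourth-power hypothesis bounds
    the inverse radius by a twelfth power of \<open>10 * R\<close>.\<close>
  have "(1 / (10 * R)) ^ 4 < \<delta>" using \<delta>(3) by (simp add: R_def)
  then have "((1 / (10 * R)) ^ 4) ^ 3 \<le> \<delta> ^ 3" using R by (intro power_mono) auto
  then have d3: "1 / (10 * R) ^ 12 \<le> \<delta> ^ 3" by (simp add: power_mult[symmetric] power_divide)
  have "exp 5 * real n / (real s * (\<delta> ^ 3 / 409600)) = exp 5 * R * 409600 / \<delta> ^ 3"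
    using s by (simp add: R_def)
  also have "\<dots> \<le> exp 5 * R * 409600 / (1 / (10 * R) ^ 12)"
    using R d3 by (intro divide_left_mono) (use \<delta> in auto)
  also have "\<dots> = exp 5 * (409600 * 10 ^ 12) * R ^ 13"
    by (simp add: power_mult_distrib power_Suc[symmetric] mult_ac eval_nat_numeral)
  \<comment> \<open>Of the 13 powers of \<open>R\<close>, one belongs to the net and twelve to
    \<delta>^3; \<open>exp 59\<close> absorbs the numerical factor. Then \<open>1 \<le> L\<close>
    merges 64 + 13 L into 77 L.\<close>
  also have "\<dots> \<le> exp 5 * exp 59 * exp L ^ 13"
  proof -
    have "409600 * 10 ^ 12 \<le> (2::real) ^ 59" by simp
    also have "\<dots> \<le> exp 59" using pow2[of 59] by simp
    finally show ?thesis using R RL by (intro mult_mono power_mono) auto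
  qed
  also have "\<dots> = exp (64 + 13 * L)" by (simp add: exp_of_nat_mult[symmetric] exp_add[symmetric])
  also have "\<dots> \<le> exp (77 * L)" using L by simp
  finally have base: "exp 5 * real n / (real s * (\<delta> ^ 3 / 409600)) \<le> exp (77 * L)" .
  have "K \<le> exp (77 * L) ^ s"
    using K(2) by (rule order_trans) (use s \<delta> base in \<open>intro power_mono; simp\<close>)
  also have "\<dots> = exp (77 * (real s * L))" by (simp add: exp_of_nat_mult[symmetric] mult_ac)
  finally have "K\<^sup>2 \<le> (exp (77 * (real s * L)))\<^sup>2" using K(1) by (intro power_mono)
  also have "\<dots> = exp (154 * (real s * L))" by (simp add: exp_of_nat_mult[symmetric])
  finally have K2: "K\<^sup>2 \<le> exp (154 * (real s * L))" .
  have "4 \<le> exp (2::real)" using pow2[of 2] by simp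
  also have "\<dots> \<le> exp (2 * (real s * L))" using sL by simp
  finally have four: "4 \<le> exp (2 * (real s * L))" .
  have "200000 * real s * L \<le> real m * \<delta>\<^sup>2"
  proof -
    have "\<delta> powr (-2) * \<delta>\<^sup>2 = 1" using \<delta> by (simp add: powr_minus powr_realpow)
    then have "200000 * real s * L = 200000 * \<delta> powr (-2) * real s * L * \<delta>\<^sup>2" by (simp add: mult_ac)
    also have "\<dots> \<le> real m * \<delta>\<^sup>2" using m by (intro mult_right_mono) (auto simp: L_def R_def)
    finally show ?thesis .
  qed
  \<comment> \<open>200000/1024 exceeds 195, so 160 is safe. It outweighs 2 + 154 and leaves
    \<open>exp (- (4 * (s * L)))\<close>, that is \<open>exp (- (2 * L))\<close> for each of the
    \<open>2 * s\<close> factors of the target.\<close>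
  then have m': "exp (- (real m * \<delta>\<^sup>2 / 1024)) \<le> exp (- (160 * (real s * L)))" using sL by simp
  have "4 * K\<^sup>2 * exp (- (real m * \<delta>\<^sup>2 / 1024)) \<le>
      exp (2 * (real s * L)) * exp (154 * (real s * L)) * exp (- (160 * (real s * L)))"
    using four K2 m' by (intro mult_mono) auto
  also have "\<dots> = exp (- (4 * (real s * L)))" by (simp add: exp_add[symmetric])
  also have "\<dots> = exp (- (2 * L)) ^ (2 * s)" by (simp add: exp_of_nat_mult[symmetric] mult_ac)
  also have "\<dots> \<le> (real s / (2 * real n)) ^ (2 * s)"
  proof (intro power_mono)
    have "2 \<le> exp L" using exp_ge_add_one_self[of L] L(1) by linarith
    then have "2 * R \<le> exp L * exp L" using RL R by (intro mult_mono) auto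
    then have "2 * R \<le> exp (2 * L)" by (simp add: exp_add[symmetric])
    then have "1 / exp (2 * L) \<le> 1 / (2 * R)" using R by (intro divide_left_mono) auto
    then show "exp (- (2 * L)) \<le> real s / (2 * real n)"
      by (simp add: exp_minus R_def inverse_eq_divide)
  qed simp
  finally show ?thesis .
qed

theorem theorem1p5:
  shows "\<exists>C::real. C \<ge> 1 \<and>
    (\<forall>(s::nat) (n::nat) (\<delta>::real) (m::nat).
       0 < s \<longrightarrow> s \<le> n \<longrightarrow> 0 < \<delta> \<longrightarrow> \<delta> < 1 \<longrightarrow>
       (real s / (10 * real n)) ^ 4 < \<delta> \<longrightarrow>
       C * \<delta> powr (-2) * real s * log_plus (real n / real s) \<le> real m \<longrightarrow>
       real m \<le> 2 * C * \<delta> powr (-2) * real s * log_plus (real n / real s) \<longrightarrow>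
       measure (gauss_space m n)
         {w \<in> space (gauss_space m n).
            \<forall>x\<in>sparse_sphere n s. \<forall>y\<in>sparse_sphere n s.
              \<bar>(1 / real m) * (\<Sum>j<m. sgn (ip n x (\<lambda>i. w (j, i))) * ip n y (\<lambda>i. w (j, i)))
                 - sqrt (2 / pi) * ip n x y\<bar> \<le> \<delta>}
       \<ge> 1 - (real s / (2 * real n)) ^ (2 * s))"
proof (intro exI[of _ 200000] conjI allI impI)
  fix s n :: nat and \<delta> :: real and m :: nat
  assume s: "0 < s" "s \<le> n" and \<delta>: "0 < \<delta>" "\<delta> < 1" "(real s / (10 * real n)) ^ 4 < \<delta>"
    and m: "200000 * \<delta> powr (-2) * real s * log_plus (real n / real s) \<le> real m"
  \<comment> \<open>409600 = 2 * 2048 * 100: the radius \<open>2 * \<eta>\<close> is then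
    \<delta>/100 times the threshold t = \<delta>^2/2048.\<close>
  define \<eta> where "\<eta> = \<delta> ^ 3 / 409600"
  have \<delta>2: "\<delta>\<^sup>2 \<le> 1" and \<delta>3: "\<delta> ^ 3 \<le> \<delta>"
    using \<delta> power_decreasing[of 1 3 \<delta>] by (auto simp: power_le_one)
  have \<eta>: "0 < \<eta>" "\<eta> < 1" using \<delta> \<delta>3 by (auto simp: \<eta>_def)
  have "0 < 200000 * \<delta> powr (-2) * real s * log_plus (real n / real s)"
    using s \<delta> by (intro mult_pos_pos) (auto simp: log_plus_def)
  from less_le_trans[OF this m] have m0: "0 < m" by simp
  obtain N where N: "finite N" "N \<subseteq> sparse_sphere n s"
    "real (card N) \<le> (exp 5 * real n / (real s * \<eta>)) ^ s"
    "\<forall>x\<in>sparse_sphere n s.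
       \<exists>u\<in>N. (\<forall>i. x i = 0 \<longrightarrow> u i = 0) \<and> nrm n (\<lambda>i. x i - u i) \<le> 2 * \<eta>"
    by (rule sparse_sphere_net[OF s \<eta>])
  interpret sparse_net n s "2 * \<eta>" N by unfold_locales (use N(2,4) in auto)
  let ?E = "exp (- (real m * \<delta>\<^sup>2 / 1024))"
  have "2 * \<eta> / (\<delta>\<^sup>2 / 2048) = \<delta> / 100"
    using \<delta> by (simp add: \<eta>_def power2_eq_square power3_eq_cube)
  then have ratio: "(2 * \<eta>)\<^sup>2 / (\<delta>\<^sup>2 / 2048)\<^sup>2 = (\<delta> / 100)\<^sup>2"
    by (simp only: power_divide[symmetric])
  \<comment> \<open>Here \<kappa> = \<delta>^2/512 is four times \<open>t\<close>, so the count
    exceeds its threshold with exponent m (2 t - \<kappa>) = -m \<delta>^2/1024. The two terms are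
    \<delta>^2/128 and 0.0064 \<delta>^2, together below \<delta>^2/64.\<close>
  have small: "4 * (\<delta>\<^sup>2 / 512) + 64 * (2 * \<eta>)\<^sup>2 / (\<delta>\<^sup>2 / 2048)\<^sup>2 \<le> \<delta>\<^sup>2 / 64"
    unfolding times_divide_eq_right[symmetric] ratio by (simp add: power_divide)
  \<comment> \<open>The count has the slowest of the three rates and serves as the common one;
    bounding the cardinality by its square gives the total factor 2 + 1 + 1 = 4.\<close>
  have "(real (card N))\<^sup>2 * (2 * exp (- (real m * \<delta>\<^sup>2 / 384))) + real (card N) * exp (- (real m / 2))
         + real (card N) * exp (real m * (2 * (\<delta>\<^sup>2 / 2048) - \<delta>\<^sup>2 / 512))
      \<le> (real (card N))\<^sup>2 * (2 * ?E) + (real (card N))\<^sup>2 * ?E + (real (card N))\<^sup>2 * ?E"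
  proof (intro add_mono mult_mono)
    have "card N \<le> (card N)\<^sup>2" by (simp add: power2_eq_square)
    then show "real (card N) \<le> (real (card N))\<^sup>2" "real (card N) \<le> (real (card N))\<^sup>2"
      by (metis of_nat_le_iff of_nat_power)+
    show "exp (- (real m / 2)) \<le> ?E"
      using mult_left_mono[OF \<delta>2, of "real m"] by simp
    show "exp (real m * (2 * (\<delta>\<^sup>2 / 2048) - \<delta>\<^sup>2 / 512)) \<le> ?E" by (simp add: algebra_simps)
  qed auto
  also have "\<dots> = 4 * (real (card N))\<^sup>2 * ?E" by simp
  also have "\<dots> \<le> (real s / (2 * real n)) ^ (2 * s)"
    using N(3) m by (intro net_size_bound[OF s \<delta>]) (auto simp: \<eta>_def)
  finally have fail: "(real (card N))\<^sup>2 * (2 * exp (- (real m * \<delta>\<^sup>2 / 384))) + real (card N) * exp (- (real m / 2))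
         + real (card N) * exp (real m * (2 * (\<delta>\<^sup>2 / 2048) - \<delta>\<^sup>2 / 512)) \<le> (real s / (2 * real n)) ^ (2 * s)" .
  have "2 * \<eta> \<le> 1 / 2" "6 * (2 * \<eta>) \<le> \<delta> / 4" "0 < \<delta>\<^sup>2 / 2048" "\<delta> \<le> 1"
    using \<delta> \<delta>3 by (auto simp: \<eta>_def)
  from failure_probability[OF m0 this(3) this(1,2) \<delta>(1) this(4) small N(1)] fail
  show "measure (gauss_space m n)
         {w \<in> space (gauss_space m n).
            \<forall>x\<in>sparse_sphere n s. \<forall>y\<in>sparse_sphere n s.
              \<bar>(1 / real m) * (\<Sum>j<m. sgn (ip n x (\<lambda>i. w (j, i))) * ip n y (\<lambda>i. w (j, i)))
                 - sqrt (2 / pi) * ip n x y\<bar> \<le> \<delta>}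
       \<ge> 1 - (real s / (2 * real n)) ^ (2 * s)"
    unfolding gvec_def by linarith
qed simp

end
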